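(* There is an absolute constant $C>0$ such that the following holds. Fix $j\in\mathbb N$ and write $\phi=\phi_j$, $\lambda=\lambda_j$. If $x\in(0,1]$ is such that $\phi'(x)$ exists, then $$\Big|x\phi'(x)+\lambda\phi(1)\widetilde B_1\!\left(\tfrac1x\right)\Big|\le C\,|\lambda|^5(\log|\lambda|)^2\Big(1+\log\tfrac1x\Big)x.$$
   Context: Let $K:[0,1]\times[0,1]\to\mathbb R$ be defined by $K(x,y)=\frac12-\{(xy)^{-1}\}$ if $0<x,y\le 1$, and $K(x,y)=0$ if $0\le x,y\le1$ and $xy=0$, where $\{\alpha\}=\alpha-\lfloor\alpha\rfloor$. Let $L^2([0,1])$ denote the space of real-valued Lebesgue measurable square-integrable functions on $[0,1]$, with $\langle f,g\rangle=\int_0^1 f(x)g(x)\,dx$ and $\|f\|=\langle f,f\rangle^{1/2}$. A function $\phi$ is an eigenfunction of $K$ (with eigenvalue $\lambda\in\mathbb R$) if $\phi\in L^2([0,1])$, $\|\phi\|>0$, and $\phi(x)=\lambda\int_0^1 K(x,y)\phi(y)\,dy$ for every $x\in[0,1]$. Let $\phi_1,\phi_2,\ldots$ be a maximal orthonormal system in $L^2([0,1])$ of eigenfunctions of $K$, $\phi_j$ having the nonzero real eigenvalue $\lambda_j$, numbered so that $0<|\lambda_1|\le|\lambda_2|\le\cdots$ and $\lambda_j\ge\lambda_{j+1}$ whenever $|\lambda_j|=|\lambda_{j+1}|$. The periodic Bernoulli function is $\widetilde B_1(t)=\{t\}-\frac12$ for $t\in\mathbb R$. *)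

theory Defs
  imports "HOL-Analysis.Analysis"
begin

definition Kker :: "real \<Rightarrow> real \<Rightarrow> real" where
  "Kker x y = (if x * y = 0 then 0 else 1/2 - frac (1 / (x * y)))"

definition B1per :: "real \<Rightarrow> real" where
  "B1per t = frac t - 1/2"

definition L2_01 :: "(real \<Rightarrow> real) \<Rightarrow> bool" where
  "L2_01 f \<longleftrightarrow> set_borel_measurable lebesgue {0..1} f
      \<and> set_integrable lebesgue {0..1} (\<lambda>x. (f x)\<^sup>2)"

definition inner01 :: "(real \<Rightarrow> real) \<Rightarrow> (real \<Rightarrow> real) \<Rightarrow> real" where
  "inner01 f g = (LINT x:{0..1}|lebesgue. f x * g x)"

definition norm01 :: "(real \<Rightarrow> real) \<Rightarrow> real" where
  "norm01 f = sqrt (inner01 f f)"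

definition eigenfun :: "(real \<Rightarrow> real) \<Rightarrow> real \<Rightarrow> bool" where
  "eigenfun phi lam \<longleftrightarrow> L2_01 phi \<and> norm01 phi > 0
      \<and> (\<forall>x\<in>{0..1}. phi x = lam * (LINT y:{0..1}|lebesgue. Kker x y * phi y))"

definition eigen_system :: "(nat \<Rightarrow> real \<Rightarrow> real) \<Rightarrow> (nat \<Rightarrow> real) \<Rightarrow> bool" where
  "eigen_system phi lam \<longleftrightarrow>
     (\<forall>j\<ge>1. eigenfun (phi j) (lam j) \<and> lam j \<noteq> 0)
   \<and> (\<forall>i\<ge>1. \<forall>j\<ge>1. inner01 (phi i) (phi j) = (if i = j then 1 else 0))
   \<and> (\<forall>psi mu. eigenfun psi mu \<and> mu \<noteq> 0 \<longrightarrow> \<not> (\<forall>j\<ge>1. inner01 psi (phi j) = 0))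
   \<and> 0 < \<bar>lam 1\<bar>
   \<and> (\<forall>j\<ge>1. \<bar>lam j\<bar> \<le> \<bar>lam (Suc j)\<bar>)
   \<and> (\<forall>j\<ge>1. \<bar>lam j\<bar> = \<bar>lam (Suc j)\<bar> \<longrightarrow> lam j \<ge> lam (Suc j))"

end

theory Submission
  imports Defs
begin

text \<open>
  Write \<open>k t = 1/2 - {1/t}\<close>, so that \<open>K(x,y) = k(xy)\<close>. Since the primitive of \<open>k\<close> is \<open>O(t\<^sup>2)\<close>, the iterated
  kernel satisfies \<open>\<bar>\<integral> k(av) k(bv) dv\<bar> \<le> min 1 (a/b)\<close>; integrating this in \<open>b\<close> produces the factor
  \<open>x (1 + log (1/x))\<close>, and in particular \<open>\<phi>(x)\<close> decays like it.

  Scaling the integration variable turns the eigenvalue equation into one for the difference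
  \<open>D(x) = \<phi>(x) - \<phi>(rx)\<close> with \<open>r < 1\<close>, whose inhomogeneous part \<open>\<lambda> \<integral>\<^bsub>r\<^esub>\<^sup>1 k(xs) \<phi>(s) ds\<close> gives the main term
  \<open>\<lambda> (1 - r) k(x) \<phi>(1)\<close>. A crude estimate \<open>D(x) = O((1 - r) / x)\<close>, obtained from the decay of \<open>\<phi>\<close>, is
  bootstrapped to \<open>D = O((1 - r) \<bar>\<lambda>\<bar>\<^sup>3 log\<^sup>2 \<bar>\<lambda>\<bar>)\<close>. Inserting the difference equation into itself brings in
  the iterated kernel, and \<open>r \<rightarrow> 1\<close> gives the theorem. Only one-sided difference quotients occur, so no
  regularity of \<open>\<phi>\<close> is needed beyond the existence of \<open>\<phi>'(x)\<close> at the given point.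
\<close>

section \<open>Oscillation of the sawtooth kernel\<close>

definition sawtooth :: "real \<Rightarrow> real" where
  "sawtooth t = (if t = 0 then 0 else 1/2 - frac (1 / t))"

lemma Kker_eq_sawtooth: "Kker x y = sawtooth (x * y)"
  by (simp add: Kker_def sawtooth_def)

lemma sawtooth_bound: "\<bar>sawtooth t\<bar> \<le> 1/2"
proof -
  have "0 \<le> frac (1/t)" "frac (1/t) < 1" by (auto simp: frac_lt_1)
  then show ?thesis unfolding sawtooth_def abs_le_iff by simp
qed

lemma measurable_sawtooth [measurable]: "sawtooth \<in> borel_measurable borel"
  unfolding sawtooth_def[abs_def] frac_def by measurable

text \<open>With B_2(t) = t^2 - t + 1/6 this is 1/12 - B_2({u})/2, so away from the integers it is a
  primitive of 1/2 - {u}. The constant of integration makes it vanish at the integers, hence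
  nonnegative.\<close>

definition frac_parabola :: "real \<Rightarrow> real" where
  "frac_parabola u = frac u * (1 - frac u) / 2"

lemma frac_parabola_bounds: "0 \<le> frac_parabola u" "frac_parabola u \<le> 1/8"
proof -
  show "0 \<le> frac_parabola u"
    using frac_lt_1[of u] by (simp add: frac_parabola_def)
  have "0 \<le> (frac u - 1/2)\<^sup>2" by simp
  then show "frac_parabola u \<le> 1/8"
    by (simp add: frac_parabola_def power2_eq_square algebra_simps)
qed

lemma measurable_frac_parabola [measurable]: "frac_parabola \<in> borel_measurable borel"
  unfolding frac_parabola_def[abs_def] frac_def by measurable

lemma frac_parabola_has_derivative:
  assumes "u \<notin> \<int>"
  shows "(frac_parabola has_real_derivative 1/2 - frac u) (at u)"
proof -
  have ev: "eventually (\<lambda>w. frac_parabola w = (w - of_int \<lfloor>u\<rfloor>) * (1 - (w - of_int \<lfloor>u\<rfloor>)) / 2) (nhds u)"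
  proof -
    have "open {of_int \<lfloor>u\<rfloor> <..< of_int \<lfloor>u\<rfloor> + (1::real)}" by simp
    moreover have "u \<in> {of_int \<lfloor>u\<rfloor> <..< of_int \<lfloor>u\<rfloor> + (1::real)}"
      using assms floor_correct[of u] Ints_of_int[of "\<lfloor>u\<rfloor>", where 'a = real]
      by (auto simp: order_less_le)
    ultimately have "eventually (\<lambda>w. w \<in> {of_int \<lfloor>u\<rfloor> <..< of_int \<lfloor>u\<rfloor> + (1::real)}) (nhds u)"
      by (rule eventually_nhds_in_open)
    then show ?thesis
    proof eventually_elim
      case (elim w)
      then have "\<lfloor>w\<rfloor> = \<lfloor>u\<rfloor>" by (intro floor_unique) auto
      then show ?case by (simp add: frac_parabola_def frac_def)
    qed
  qed
  have "((\<lambda>w. (w - of_int \<lfloor>u\<rfloor>) * (1 - (w - of_int \<lfloor>u\<rfloor>)) / 2) has_real_derivative 1/2 - frac u) (at u)"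
    by (auto intro!: derivative_eq_intros simp: frac_def field_simps)
  then show ?thesis
    using DERIV_cong_ev[OF refl ev refl] by simp
qed

text \<open>Serves continuity at an integer n, where \<open>frac\<close> jumps: just to the right of
  n the factor \<open>frac u\<close> is small, just to the left the factor
  \<open>1 - frac u\<close>. At distance 1 or more the bound 1/8 suffices.\<close>

lemma frac_parabola_le_dist_int: "frac_parabola u \<le> \<bar>u - of_int n\<bar>"
proof (cases "\<bar>u - of_int n\<bar> < 1")
  case True
  show ?thesis
  proof (cases "u \<ge> of_int n")
    case T: True
    then have "\<lfloor>u\<rfloor> = n" using True by (intro floor_unique) auto
    then have "frac u = u - of_int n" by (simp add: frac_def)
    moreover have "frac u * (1 - frac u) \<le> frac u * 1"
      by (intro mult_left_mono) auto
    ultimately show ?thesis using T by (simp add: frac_parabola_def)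
  next
    case F: False
    then have "\<lfloor>u\<rfloor> = n - 1" using True by (intro floor_unique) auto
    then have eq: "1 - frac u = of_int n - u" by (simp add: frac_def)
    have "frac u * (1 - frac u) \<le> 1 * (1 - frac u)"
      using frac_lt_1[of u] by (intro mult_right_mono) auto
    then have "frac_parabola u \<le> (1 - frac u) / 2" by (simp add: frac_parabola_def)
    also have "\<dots> \<le> \<bar>u - of_int n\<bar>" unfolding eq using F by simp
    finally show ?thesis .
  qed
next
  case False
  then show ?thesis using frac_parabola_bounds(2)[of u] by simp
qed

lemma isCont_frac_parabola: "isCont frac_parabola u"
proof (cases "u \<in> \<int>")
  case False
  then show ?thesis using frac_parabola_has_derivative DERIV_isCont by blast
next
  case True
  then obtain n where n: "u = of_int n" by (auto elim: Ints_cases)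
  have "(frac_parabola \<longlongrightarrow> 0) (at u)"
  proof (rule Lim_null_comparison)
    show "eventually (\<lambda>w. norm (frac_parabola w) \<le> \<bar>w - u\<bar>) (at u)"
      using frac_parabola_le_dist_int[of _ n] frac_parabola_bounds by (simp add: n)
    show "((\<lambda>w. \<bar>w - u\<bar>) \<longlongrightarrow> 0) (at u)"
      by (auto intro!: tendsto_eq_intros)
  qed
  then show ?thesis by (simp add: isCont_def n frac_parabola_def)
qed

lemma set_integrable_bounded_borel:
  fixes f :: "real \<Rightarrow> real"
  assumes [measurable]: "f \<in> borel_measurable borel" and "\<And>x. x \<in> {a..b} \<Longrightarrow> \<bar>f x\<bar> \<le> B"
  shows "set_integrable lborel {a..b} f"
proof -
  have "set_integrable lborel {a..b} (\<lambda>_. B)"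
    by (auto simp: set_integrable_def intro!: integrable_real_indicator simp: emeasure_lborel_Icc_eq)
  then show ?thesis
    by (rule set_integrable_bound)
       (use assms in \<open>auto simp: set_borel_measurable_def intro!: AE_I2 order_trans[OF _ abs_ge_self]\<close>)
qed

lemma integrable_on_bounded_borel:
  fixes f :: "real \<Rightarrow> real"
  assumes "f \<in> borel_measurable borel" and "\<And>x. x \<in> {a..b} \<Longrightarrow> \<bar>f x\<bar> \<le> B"
  shows "f integrable_on {a..b}"
  using set_borel_integral_eq_integral(1)[OF set_integrable_bounded_borel[OF assms]] .

section \<open>Integral bounds for the sawtooth, alone and against decreasing weights\<close>

lemma sawtooth_integrable_on: "(\<lambda>s. sawtooth (a * s)) integrable_on {c..d}"
proof (rule integrable_on_bounded_borel)
  show "\<bar>sawtooth (a * s)\<bar> \<le> 1/2" for s by (rule sawtooth_bound)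
qed measurable

text \<open>Integration by parts: with P for \<open>frac_parabola\<close> and k for
  \<open>sawtooth\<close>, the function -a s^2 P(1/(as)) has derivative k(as) - 2as P(1/(as)), and P
  is bounded by 1/8.\<close>

lemma sawtooth_integral_away_from_0:
  assumes a: "0 < a" and e: "0 < d" "d \<le> e"
  shows "\<bar>integral {d..e} (\<lambda>s. sawtooth (a * s))\<bar> \<le> a * e\<^sup>2 / 8"
proof -
  define H where "H s = - a * s\<^sup>2 * frac_parabola (1 / (a * s))" for s
  \<comment> \<open>The points where 1/(as) is an integer. Those in [d, e] have an integer at most
    1/(ad), so a finite set suffices; n = 0 only contributes the point 0, which lies outside
    [d, e].\<close>
  define S where "S = (\<lambda>n. 1 / (a * of_int n)) ` {0..\<lceil>1 / (a * d)\<rceil>}"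
  have "((\<lambda>s. sawtooth (a * s) - 2 * a * s * frac_parabola (1 / (a * s))) has_integral (H e - H d)) {d..e}"
  proof (rule fundamental_theorem_of_calculus_strong[where S = S])
    show "finite S" by (simp add: S_def)
    show "d \<le> e" by fact
    show "continuous_on {d..e} H"
      unfolding H_def using a e
      by (intro continuous_intros continuous_at_imp_continuous_on ballI
            continuous_within_compose3[OF isCont_frac_parabola]) auto
    fix s assume s: "s \<in> {d..e} - S"
    then have s0: "s > 0" using e by auto
    have nz: "1 / (a * s) \<notin> \<int>"
    proof
      assume "1 / (a * s) \<in> \<int>"
      then obtain n :: int where n: "1 / (a * s) = of_int n" by (auto elim: Ints_cases)
      then have n0: "of_int n > (0::real)" using a s0 by (metis divide_pos_pos mult_pos_pos zero_less_one)
      have "1 / (a * s) \<le> 1 / (a * d)" using a s0 s e by (auto intro!: divide_left_mono)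
      then have "n \<le> \<lceil>1 / (a * d)\<rceil>" using n by linarith
      moreover have "s = 1 / (a * of_int n)" using n n0 a s0 by (simp add: field_simps)
      ultimately have "s \<in> S" using n0 by (auto simp: S_def)
      with s show False by blast
    qed
    have "((\<lambda>s. frac_parabola (1 / (a * s))) has_real_derivative (1/2 - frac (1 / (a * s))) * (- (1 / (a * s\<^sup>2)))) (at s)"
    proof (rule DERIV_chain2[where f = frac_parabola], rule frac_parabola_has_derivative[OF nz])
      show "((\<lambda>s. 1 / (a * s)) has_real_derivative - (1 / (a * s\<^sup>2))) (at s)"
        using a s0 by (auto intro!: derivative_eq_intros simp: field_simps power2_eq_square)
    qed
    then have "(H has_real_derivative (sawtooth (a * s) - 2 * a * s * frac_parabola (1 / (a * s)))) (at s)"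
      unfolding H_def using a s0
      by (auto intro!: derivative_eq_intros simp: sawtooth_def power2_eq_square field_simps)
    then show "(H has_vector_derivative (sawtooth (a * s) - 2 * a * s * frac_parabola (1 / (a * s)))) (at s)"
      by (simp add: has_real_derivative_iff_has_vector_derivative)
  qed
  then have eq: "integral {d..e} (\<lambda>s. sawtooth (a * s) - 2 * a * s * frac_parabola (1 / (a * s))) = H e - H d"
    by (rule integral_unique)
  have int1: "(\<lambda>s. sawtooth (a * s)) integrable_on {d..e}"
    by (rule sawtooth_integrable_on)
  have b2: "\<bar>2 * a * s * frac_parabola (1 / (a * s))\<bar> \<le> 2 * a * s * (1/8)" if "s \<ge> 0" for s
    using a that frac_parabola_bounds[of "1 / (a * s)"]
    by (simp only: abs_mult) (intro mult_mono, auto)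
  have int2: "(\<lambda>s. 2 * a * s * frac_parabola (1 / (a * s))) integrable_on {d..e}"
  proof (rule integrable_on_bounded_borel[where B = "2 * a * e * (1/8)"])
    fix s assume "s \<in> {d..e}"
    then show "\<bar>2 * a * s * frac_parabola (1 / (a * s))\<bar> \<le> 2 * a * e * (1/8)"
      using b2[of s] a e by (intro order_trans[OF b2]) auto
  qed measurable
  have lin: "((\<lambda>s. 2 * a * s * (1/8)) has_integral (a * e\<^sup>2 / 8 - a * d\<^sup>2 / 8)) {d..e}"
    by (rule fundamental_theorem_of_calculus[OF e(2)])
       (auto intro!: derivative_eq_intros simp flip: has_real_derivative_iff_has_vector_derivative)
  have up: "integral {d..e} (\<lambda>s. 2 * a * s * frac_parabola (1 / (a * s))) \<le> a * e\<^sup>2 / 8 - a * d\<^sup>2 / 8"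
    using e by (intro has_integral_le[OF integrable_integral[OF int2] lin] order_trans[OF abs_ge_self b2]) auto
  have lo: "0 \<le> integral {d..e} (\<lambda>s. 2 * a * s * frac_parabola (1 / (a * s)))"
    using e a by (intro integral_nonneg int2) (auto simp: frac_parabola_bounds)
  have "integral {d..e} (\<lambda>s. sawtooth (a * s))
     = H e - H d + integral {d..e} (\<lambda>s. 2 * a * s * frac_parabola (1 / (a * s)))"
    using integral_diff[OF int1 int2] eq by simp
  \<comment> \<open>\<open>- H e\<close>, \<open>- H d\<close> and the remaining integral are all
    nonnegative. The lower bound therefore comes from \<open>H e\<close> alone, and in the upper
    bound the term -a d^2/8 of \<open>up\<close> cancels the bound for \<open>- H d\<close>.\<close>
  moreover have "0 \<le> a * s\<^sup>2 * frac_parabola (1 / (a * s))"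
    "a * s\<^sup>2 * frac_parabola (1 / (a * s)) \<le> a * s\<^sup>2 * (1/8)" for s
    using frac_parabola_bounds[of "1 / (a * s)"] a
    by (intro mult_nonneg_nonneg mult_left_mono; simp)+
  note this[of e] this[of d]
  ultimately show ?thesis using up lo unfolding H_def abs_le_iff by (auto simp: algebra_simps)
qed

text \<open>The break points 1/(an) accumulate at 0, so 0 is reached by a limit: the piece next to 0
  contributes at most its length.\<close>

lemma sawtooth_integral_bound:
  assumes a: "0 < a" and e: "0 \<le> e"
  shows "\<bar>integral {0..e} (\<lambda>s. sawtooth (a * s))\<bar> \<le> a * e\<^sup>2 / 8"
proof (cases "e = 0")
  case False
  with e have e0: "0 < e" by simp
  have int: "(\<lambda>s. sawtooth (a * s)) integrable_on {c..c'}" for c c'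
    by (rule sawtooth_integrable_on)
  have "\<bar>integral {0..e} (\<lambda>s. sawtooth (a * s))\<bar> \<le> a * e\<^sup>2 / 8 + d" if "d > 0" for d
  proof -
    define d' where "d' = min d e"
    have d': "0 < d'" "d' \<le> e" "d' \<le> d" using that e0 by (auto simp: d'_def)
    have "norm (integral {0..d'} (\<lambda>s. sawtooth (a * s))) \<le> integral {0..d'} (\<lambda>_. 1/2)"
      by (intro integral_norm_bound_integral int) (use sawtooth_bound in auto)
    then have "\<bar>integral {0..d'} (\<lambda>s. sawtooth (a * s))\<bar> \<le> d'" using d' by simp
    moreover have "integral {0..d'} (\<lambda>s. sawtooth (a * s)) + integral {d'..e} (\<lambda>s. sawtooth (a * s))
        = integral {0..e} (\<lambda>s. sawtooth (a * s))"
      using d' by (intro Henstock_Kurzweil_Integration.integral_combine int) auto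
    ultimately show ?thesis
      using sawtooth_integral_away_from_0[OF a d'(1,2)] d'(3) by linarith
  qed
  then show ?thesis by (rule field_le_epsilon)
qed simp

text \<open>By the second mean value theorem, the sign of all primitives \<open>\<integral>\<^sub>0\<^sup>c p\<close> is inherited by
  \<open>\<integral> F p\<close> for decreasing \<open>F \<ge> 0\<close>.\<close>

lemma integral_antimono_weight_le_0:
  fixes p F :: "real \<Rightarrow> real"
  assumes p: "p integrable_on {0..1}"
    and neg: "\<And>c. c \<in> {0..1} \<Longrightarrow> integral {0..c} p \<le> 0"
    and F: "\<And>x y. \<lbrakk>0 \<le> x; x \<le> y; y \<le> 1\<rbrakk> \<Longrightarrow> F y \<le> F x" and F1: "0 \<le> F 1"
  shows "integral {0..1} (\<lambda>x. F x * p x) \<le> 0"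
proof -
  obtain c where c: "c \<in> {0..1}"
    and eq: "integral {0..1} (\<lambda>x. - F x * p x) = - F 0 * integral {0..c} p + - F 1 * integral {c..1} p"
    by (rule second_mean_value_theorem[OF p, of "\<lambda>x. - F x"]) (use F in auto)
  have comb: "integral {0..c} p + integral {c..1} p = integral {0..1} p"
    using c p by (intro Henstock_Kurzweil_Integration.integral_combine) auto
  have "integral {0..1} (\<lambda>x. F x * p x) = F 0 * integral {0..c} p + F 1 * integral {c..1} p"
    using eq by simp
  also have "\<dots> = (F 0 - F 1) * integral {0..c} p + F 1 * integral {0..1} p"
    by (simp add: algebra_simps flip: comb)
  also have "\<dots> \<le> 0"
    using neg[of c] neg[of 1] c F[of 0 1] F1
    by (intro add_nonpos_nonpos mult_nonneg_nonpos) auto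
  finally show ?thesis .
qed

text \<open>The comparison function a v/4 has the primitive a d^2/8, exactly the bound for the
  primitives of the sawtooth. Plus or minus the sawtooth, less this function, thus has nonpositive
  primitives, and \<open>integral_antimono_weight_le_0\<close> inserts the weight F.\<close>

lemma sawtooth_antimono_integral_bound:
  fixes F :: "real \<Rightarrow> real"
  assumes a: "0 < a" and [measurable]: "F \<in> borel_measurable borel"
    and F: "\<And>x y. \<lbrakk>0 \<le> x; x \<le> y; y \<le> 1\<rbrakk> \<Longrightarrow> F y \<le> F x" and F1: "0 \<le> F 1"
    and c: "\<And>x. x \<in> {0..1} \<Longrightarrow> x * F x \<le> c"
  shows "\<bar>integral {0..1} (\<lambda>v. F v * sawtooth (a * v))\<bar> \<le> a * c / 4"
proof -
  have Fb: "\<bar>F x\<bar> \<le> F 0" if "x \<in> {0..1}" for x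
    using F[of 0 x] F[of x 1] F1 that by auto
  have i1: "(\<lambda>v. F v * sawtooth (a * v)) integrable_on {0..1}"
  proof (rule integrable_on_bounded_borel[where B = "F 0 * (1/2)"])
    show "\<bar>F x * sawtooth (a * x)\<bar> \<le> F 0 * (1/2)" if "x \<in> {0..1}" for x
      using Fb[OF that] unfolding abs_mult by (intro mult_mono sawtooth_bound) auto
  qed measurable
  have i2: "(\<lambda>v. v * F v) integrable_on {0..1}"
  proof (rule integrable_on_bounded_borel[where B = "1 * F 0"])
    show "\<bar>x * F x\<bar> \<le> 1 * F 0" if "x \<in> {0..1}" for x
      using Fb[OF that] that unfolding abs_mult by (intro mult_mono) auto
  qed measurable
  have c': "integral {0..1} (\<lambda>v. v * F v) \<le> c"
    using integral_le[OF i2, of "\<lambda>_. c"] c by auto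
  have main: "integral {0..1} (\<lambda>v. F v * (\<sigma> * sawtooth (a * v) - a / 4 * v)) \<le> 0"
    if \<sigma>: "\<bar>\<sigma>\<bar> = 1" for \<sigma> :: real
  proof (rule integral_antimono_weight_le_0)
    have s: "(\<lambda>v. \<sigma> * sawtooth (a * v)) integrable_on {0..d}" for d
      by (intro integrable_on_mult_right sawtooth_integrable_on)
    have l: "((\<lambda>v. a / 4 * v) has_integral (a * d\<^sup>2 / 8)) {0..d}" if "0 \<le> d" for d
    proof -
      have "((\<lambda>v. a / 4 * v) has_integral (a * d\<^sup>2 / 8 - a * 0\<^sup>2 / 8)) {0..d}"
        by (rule fundamental_theorem_of_calculus[OF that])
           (auto intro!: derivative_eq_intros simp flip: has_real_derivative_iff_has_vector_derivative)
      then show ?thesis by simp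
    qed
    show "(\<lambda>v. \<sigma> * sawtooth (a * v) - a / 4 * v) integrable_on {0..1}"
      using s l[of 1] by (intro integrable_diff) auto
    show "integral {0..d} (\<lambda>v. \<sigma> * sawtooth (a * v) - a / 4 * v) \<le> 0" if "d \<in> {0..1}" for d
    proof -
      have "integral {0..d} (\<lambda>v. \<sigma> * sawtooth (a * v) - a / 4 * v)
         = \<sigma> * integral {0..d} (\<lambda>v. sawtooth (a * v)) - a * d\<^sup>2 / 8"
        using s[of d] l[of d] that
        by (subst integral_diff) (auto simp: integral_unique[OF l] intro: has_integral_integrable[OF l])
      moreover have "\<sigma> * integral {0..d} (\<lambda>v. sawtooth (a * v)) \<le> \<bar>integral {0..d} (\<lambda>v. sawtooth (a * v))\<bar>"
        using \<sigma> by (metis abs_ge_self abs_mult mult_1)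
      ultimately show ?thesis
        using sawtooth_integral_bound[OF a, of d] that by auto
    qed
  qed (use F F1 in auto)
  have "\<sigma> * integral {0..1} (\<lambda>v. F v * sawtooth (a * v)) \<le> a / 4 * integral {0..1} (\<lambda>v. v * F v)"
    if \<sigma>: "\<bar>\<sigma>\<bar> = 1" for \<sigma> :: real
  proof -
    have "integral {0..1} (\<lambda>v. F v * (\<sigma> * sawtooth (a * v) - a / 4 * v))
       = integral {0..1} (\<lambda>v. \<sigma> * (F v * sawtooth (a * v)) - a / 4 * (v * F v))"
      by (simp add: algebra_simps)
    also have "\<dots> = \<sigma> * integral {0..1} (\<lambda>v. F v * sawtooth (a * v)) - a / 4 * integral {0..1} (\<lambda>v. v * F v)"
      using i1 i2 by (subst integral_diff) (auto intro!: integrable_on_mult_right)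
    finally show ?thesis using main[OF \<sigma>] by simp
  qed
  from this[of 1] this[of "-1"]
  have "\<bar>integral {0..1} (\<lambda>v. F v * sawtooth (a * v))\<bar> \<le> a / 4 * integral {0..1} (\<lambda>v. v * F v)"
    by (auto simp: abs_le_iff)
  also have "\<dots> \<le> a / 4 * c"
    using a c' by (intro mult_left_mono) auto
  finally show ?thesis by simp
qed

text \<open>The second factor is 1/2 - 1/(bv) + floor(1/(bv)), a combination of three nonnegative
  decreasing weights. Each has v F(v) at most 1/b, for the constant weight because b is at most 1,
  so each contributes at most a/(4b).\<close>

lemma sawtooth_iterated_bound:
  assumes a: "0 < a" and b: "0 < b" "b \<le> 1"
  shows "\<bar>integral {0..1} (\<lambda>v. sawtooth (a * v) * sawtooth (b * v))\<bar> \<le> a / b"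
proof (rule field_le_epsilon)
  fix d :: real assume "d > 0"
  \<comment> \<open>Truncating v at e keeps the weights bounded near 0. The two integrands agree
    from e on and differ by at most 1/2 before, so the truncation costs at most e.\<close>
  define e where "e = min d 1"
  have e: "0 < e" "e \<le> d" "e \<le> 1" using \<open>d > 0\<close> by (auto simp: e_def)
  define s where "s v = sawtooth (a * v)" for v
  define F G where "F v = 1 / (b * max v e)" and "G v = real_of_int \<lfloor>1 / (b * max v e)\<rfloor>" for v :: real
  have [measurable]: "s \<in> borel_measurable borel" "F \<in> borel_measurable borel" "G \<in> borel_measurable borel"
    unfolding s_def[abs_def] F_def[abs_def] G_def[abs_def] by measurable
  have Fmono: "F y \<le> F x" if "x \<le> y" for x y
    using that e b by (auto simp: F_def intro!: divide_left_mono mult_left_mono)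
  have Gmono: "G y \<le> G x" if "x \<le> y" for x y
    using Fmono[OF that] by (auto simp: F_def G_def intro!: floor_mono)
  have Fnn: "0 \<le> F x" for x using e b by (auto simp: F_def)
  have GF: "0 \<le> G x" "G x \<le> F x" for x using Fnn[of x] by (auto simp: G_def F_def)
  have xF: "x * F x \<le> 1 / b" if "x \<in> {0..1}" for x
    using that e b by (auto simp: F_def field_simps max_def)
  have xG: "x * G x \<le> 1 / b" if "x \<in> {0..1}" for x
    using xF[OF that] GF[of x] that mult_left_mono[of "G x" "F x" x] by auto
  have I1: "\<bar>integral {0..1} (\<lambda>v. F v * s v)\<bar> \<le> a * (1 / b) / 4"
    unfolding s_def by (intro sawtooth_antimono_integral_bound a Fmono Fnn xF) auto
  have I2: "\<bar>integral {0..1} (\<lambda>v. G v * s v)\<bar> \<le> a * (1 / b) / 4"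
    unfolding s_def by (intro sawtooth_antimono_integral_bound a Gmono GF xG) auto
  have I3: "\<bar>integral {0..1} (\<lambda>v. (1/2) * s v)\<bar> \<le> a * 1 / 4"
    unfolding s_def by (intro sawtooth_antimono_integral_bound a) auto
  have sb: "\<bar>s v\<bar> \<le> 1/2" for v unfolding s_def by (rule sawtooth_bound)
  have i1: "(\<lambda>v. F v * s v) integrable_on {0..1}"
  proof (rule integrable_on_bounded_borel[where B = "F 0 * (1/2)"])
    show "\<bar>F v * s v\<bar> \<le> F 0 * (1/2)" if "v \<in> {0..1}" for v
      unfolding abs_mult using Fmono[of 0 v] Fnn[of v] Fnn[of 0] that by (intro mult_mono sb) auto
  qed measurable
  have i2: "(\<lambda>v. G v * s v) integrable_on {0..1}"
  proof (rule integrable_on_bounded_borel[where B = "G 0 * (1/2)"])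
    show "\<bar>G v * s v\<bar> \<le> G 0 * (1/2)" if "v \<in> {0..1}" for v
      unfolding abs_mult using Gmono[of 0 v] GF[of v] GF[of 0] that by (intro mult_mono sb) auto
  qed measurable
  have i3: "(\<lambda>v. (1/2) * s v) integrable_on {0..1}"
    unfolding s_def by (intro integrable_on_mult_right sawtooth_integrable_on)
  have prodb: "\<bar>s v * sawtooth t\<bar> \<le> 1/4" for v t
    using mult_mono[OF sb[of v] sawtooth_bound[of t]] by (simp add: abs_mult)
  have i4: "(\<lambda>v. s v * sawtooth (b * v)) integrable_on {0..1}"
    by (rule integrable_on_bounded_borel[where B = "1/4"]) (use prodb in auto)
  have i5: "(\<lambda>v. s v * sawtooth (b * max v e)) integrable_on {0..1}"
    by (rule integrable_on_bounded_borel[where B = "1/4"]) (use prodb in auto)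
  have "integral {0..1} (\<lambda>v. s v * sawtooth (b * max v e))
      = integral {0..1} (\<lambda>v. (1/2) * s v - F v * s v + G v * s v)"
    using e b by (intro integral_cong) (auto simp: sawtooth_def F_def G_def frac_def algebra_simps)
  also have "\<dots> = integral {0..1} (\<lambda>v. (1/2) * s v) - integral {0..1} (\<lambda>v. F v * s v) + integral {0..1} (\<lambda>v. G v * s v)"
    using i1 i2 i3 by (simp add: integral_add integral_diff integrable_diff)
  finally have eq: "integral {0..1} (\<lambda>v. s v * sawtooth (b * max v e)) = integral {0..1} (\<lambda>v. (1/2) * s v) - integral {0..1} (\<lambda>v. F v * s v) + integral {0..1} (\<lambda>v. G v * s v)" .
  have A: "\<bar>integral {0..1} (\<lambda>v. s v * sawtooth (b * max v e))\<bar> \<le> a / b"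
  proof -
    have "a \<le> a * (1 / b)" using a b mult_left_mono[of 1 "1 / b" a] by simp
    then show ?thesis using I1 I2 I3 unfolding eq abs_le_iff by simp
  qed
  have "integral {0..1} (\<lambda>v. s v * sawtooth (b * v)) - integral {0..1} (\<lambda>v. s v * sawtooth (b * max v e))
      = integral {0..1} (\<lambda>v. s v * sawtooth (b * v) - s v * sawtooth (b * max v e))"
    using i4 i5 by (simp add: integral_diff)
  also have "norm \<dots> \<le> integral {0..1} (\<lambda>v. if v \<in> {0..e} then 1 else (0::real))"
  proof (rule integral_norm_bound_integral)
    show "(\<lambda>v. s v * sawtooth (b * v) - s v * sawtooth (b * max v e)) integrable_on {0..1}"
      using i4 i5 by (intro integrable_diff)
    show "(\<lambda>v. if v \<in> {0..e} then 1 else (0::real)) integrable_on {0..1}"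
      by (rule integrable_on_bounded_borel[where B = 1]) auto
    fix v :: real assume "v \<in> {0..1}"
    then show "norm (s v * sawtooth (b * v) - s v * sawtooth (b * max v e)) \<le> (if v \<in> {0..e} then 1 else 0)"
      using prodb[of v "b * v"] prodb[of v "b * max v e"] by (auto simp: max_def abs_le_iff)
  qed
  also have "\<dots> = e"
  proof (rule integral_unique)
    show "((\<lambda>v. if v \<in> {0..e} then 1 else (0::real)) has_integral e) {0..1}"
      using e has_integral_const_real[of "1::real" 0 e] by (subst has_integral_restrict) auto
  qed
  finally show "\<bar>integral {0..1} (\<lambda>v. sawtooth (a * v) * sawtooth (b * v))\<bar> \<le> a / b + d"
    using A e by (simp add: s_def)
qed

section \<open>Integrals over the unit interval\<close>

text \<open>Borel rather than Lebesgue measure, so that product measurability and Fubini are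
  directly available; \<open>eigenfun_bounded_eigenfunction\<close> passes from one to the
  other.\<close>

abbreviation unit_lborel :: "real measure" where
  "unit_lborel \<equiv> restrict_space lborel {0..1}"

lemma measurable_unit_lborel [measurable (raw)]:
  "f \<in> borel_measurable borel \<Longrightarrow> f \<in> borel_measurable unit_lborel"
  by (rule measurable_restrict_space1) simp

lemma finite_measure_unit_lborel: "finite_measure unit_lborel"
  by (rule finite_measureI) (simp add: emeasure_restrict_space space_restrict_space)

lemma measure_unit_lborel_UNIV: "measure unit_lborel {0..1} = 1"
  by (simp add: measure_restrict_space)

lemma integral_unit_lborel_const [simp]: "(\<integral>x. c \<partial>unit_lborel) = (c::real)"
  by (simp add: space_restrict_space measure_unit_lborel_UNIV)

lemma integrable_unit_lborel_bounded:
  fixes f :: "real \<Rightarrow> real"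
  assumes "f \<in> borel_measurable borel" and "\<And>x. x \<in> {0..1} \<Longrightarrow> \<bar>f x\<bar> \<le> B"
  shows "integrable unit_lborel f"
  using set_integrable_bounded_borel[OF assms] by (simp add: integrable_restrict_space set_integrable_def)

lemma integral_unit_lborel_eq_integral:
  fixes f :: "real \<Rightarrow> real"
  assumes "f \<in> borel_measurable borel" and "\<And>x. x \<in> {0..1} \<Longrightarrow> \<bar>f x\<bar> \<le> B"
  shows "integral\<^sup>L unit_lborel f = integral {0..1} f"
  using set_borel_integral_eq_integral(2)[OF set_integrable_bounded_borel[OF assms]]
  by (simp add: integral_restrict_space set_lebesgue_integral_def)

lemma abs_integral_unit_lborel_le:
  fixes f g :: "real \<Rightarrow> real"
  assumes "f \<in> borel_measurable borel" "integrable unit_lborel g" "\<And>x. x \<in> {0..1} \<Longrightarrow> \<bar>f x\<bar> \<le> g x"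
  shows "\<bar>integral\<^sup>L unit_lborel f\<bar> \<le> integral\<^sup>L unit_lborel g"
proof -
  have "integrable unit_lborel f"
    by (rule Bochner_Integration.integrable_bound[OF assms(2)])
       (use assms in \<open>auto simp: space_restrict_space intro!: AE_I2 order_trans[OF _ abs_ge_self]\<close>)
  then have "norm (integral\<^sup>L unit_lborel f) \<le> (\<integral>x. norm (f x) \<partial>unit_lborel)"
    by simp
  also have "\<dots> \<le> integral\<^sup>L unit_lborel g"
    using assms \<open>integrable unit_lborel f\<close> by (intro integral_mono) (auto simp: space_restrict_space)
  finally show ?thesis by simp
qed

lemma unit_lborel_Fubini:
  fixes h :: "real \<Rightarrow> real \<Rightarrow> real"
  assumes [measurable]: "case_prod h \<in> borel_measurable (borel \<Otimes>\<^sub>M borel)" and B: "\<And>x y. \<bar>h x y\<bar> \<le> B"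
  shows "(\<integral>x. (\<integral>y. h x y \<partial>unit_lborel) \<partial>unit_lborel) = (\<integral>y. (\<integral>x. h x y \<partial>unit_lborel) \<partial>unit_lborel)"
proof -
  interpret U: finite_measure unit_lborel by (rule finite_measure_unit_lborel)
  interpret UU: pair_sigma_finite unit_lborel unit_lborel ..
  interpret P: finite_measure "unit_lborel \<Otimes>\<^sub>M unit_lborel"
    by (intro finite_measure_pair_measure finite_measure_unit_lborel)
  have id: "(\<lambda>x. x) \<in> unit_lborel \<rightarrow>\<^sub>M borel" by measurable
  have "(\<lambda>p. (fst p, snd p)) \<in> unit_lborel \<Otimes>\<^sub>M unit_lborel \<rightarrow>\<^sub>M borel \<Otimes>\<^sub>M borel"
    by (intro measurable_Pair measurable_compose[OF measurable_fst id] measurable_compose[OF measurable_snd id])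
  from measurable_compose[OF this assms(1)]
  have [measurable]: "case_prod h \<in> borel_measurable (unit_lborel \<Otimes>\<^sub>M unit_lborel)"
    by (simp add: case_prod_beta')
  have "integrable (unit_lborel \<Otimes>\<^sub>M unit_lborel) (case_prod h)"
    by (rule P.integrable_const_bound[where B = B]) (auto intro!: AE_I2 B)
  then show ?thesis by (rule UU.Fubini_integral[symmetric])
qed

lemma borel_measurable_unit_integral:
  fixes h :: "real \<Rightarrow> real \<Rightarrow> real"
  assumes [measurable]: "case_prod h \<in> borel_measurable (borel \<Otimes>\<^sub>M borel)"
  shows "(\<lambda>x. \<integral>y. h x y \<partial>unit_lborel) \<in> borel_measurable borel"
proof -
  have "(\<lambda>x. \<integral>y. indicator {0..1} y *\<^sub>R h x y \<partial>lborel) \<in> borel_measurable borel"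
    by measurable
  then show ?thesis by (simp add: integral_restrict_space)
qed

section \<open>The iterated kernel and its majorant \<open>min 1 (x / z)\<close>\<close>

lemma has_integral_min_1_over:
  assumes x: "0 < x" "x \<le> (1::real)"
  shows "((\<lambda>z. min 1 (x / z)) has_integral x * (1 + ln (1 / x))) {0..1}"
proof -
  have "((\<lambda>z. min 1 (x / z)) has_integral x) {0..x}"
  \<comment> \<open>Since \<open>x / 0 = 0\<close>, the integrand is 0 instead of 1 at the
    origin.\<close>
  proof (rule has_integral_spike_finite[of "{0}"])
    show "((\<lambda>_. 1) has_integral x) {0..x}"
      using has_integral_const_real[of "1::real" 0 x] x by simp
  qed (auto simp: min_def field_simps)
  moreover have "((\<lambda>z. x * (1 / z)) has_integral (x * ln 1 - x * ln x)) {x..1}"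
    by (rule fundamental_theorem_of_calculus)
       (use x in \<open>auto intro!: derivative_eq_intros simp flip: has_real_derivative_iff_has_vector_derivative\<close>)
  then have "((\<lambda>z. min 1 (x / z)) has_integral (x * ln 1 - x * ln x)) {x..1}"
    by (rule has_integral_eq[rotated]) (use x in \<open>auto simp: min_def field_simps\<close>)
  ultimately have "((\<lambda>z. min 1 (x / z)) has_integral (x + (x * ln 1 - x * ln x))) {0..1}"
    using x by (intro has_integral_combine) auto
  moreover have "x + (x * ln 1 - x * ln x) = x * (1 + ln (1 / x))"
    using x by (simp add: ln_div algebra_simps)
  ultimately show ?thesis by simp
qed

lemma integral_min_1_over:
  assumes x: "0 < x" "x \<le> (1::real)"
  shows "integrable unit_lborel (\<lambda>z. min 1 (x / z))"
    and "(\<integral>z. min 1 (x / z) \<partial>unit_lborel) = x * (1 + ln (1 / x))"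
proof -
  have *: "(\<lambda>z. min 1 (x / z)) \<in> borel_measurable borel" by measurable
  have b: "\<bar>min 1 (x / z)\<bar> \<le> 1" if "z \<in> {0..1}" for z
    using that x by (auto simp: abs_le_iff min_def intro: order_trans[of _ 0])
  show "integrable unit_lborel (\<lambda>z. min 1 (x / z))"
    by (rule integrable_unit_lborel_bounded[OF * b])
  show "(\<integral>z. min 1 (x / z) \<partial>unit_lborel) = x * (1 + ln (1 / x))"
    using integral_unit_lborel_eq_integral[OF * b] integral_unique[OF has_integral_min_1_over[OF x]] by simp
qed

text \<open>As K is symmetric, this is the kernel of the square of the integral operator, with outer
  variables a and b.\<close>

definition sawtooth2 :: "real \<Rightarrow> real \<Rightarrow> real" where
  "sawtooth2 a b = (\<integral>v. sawtooth (a * v) * sawtooth (b * v) \<partial>unit_lborel)"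

lemma sawtooth2_bound:
  assumes "0 \<le> a" "0 \<le> b" "b \<le> 1"
  shows "\<bar>sawtooth2 a b\<bar> \<le> min 1 (a / b)"
\<comment> \<open>In these cases both sides vanish, because \<open>sawtooth 0 = 0\<close> and
  \<open>a / 0 = 0\<close>.\<close>
proof (cases "a = 0 \<or> b = 0")
  case True
  then show ?thesis using assms by (auto simp: sawtooth2_def sawtooth_def[of 0])
next
  case False
  have *: "\<bar>sawtooth (a * v) * sawtooth (b * v)\<bar> \<le> 1" for v
    using mult_mono[OF sawtooth_bound[of "a * v"] sawtooth_bound[of "b * v"]] by (simp add: abs_mult)
  have "sawtooth2 a b = integral {0..1} (\<lambda>v. sawtooth (a * v) * sawtooth (b * v))"
    unfolding sawtooth2_def by (rule integral_unit_lborel_eq_integral[where B = 1]) (use * in auto)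
  moreover have "\<bar>sawtooth2 a b\<bar> \<le> 1"
    unfolding sawtooth2_def
    using abs_integral_unit_lborel_le[of "\<lambda>v. sawtooth (a * v) * sawtooth (b * v)" "\<lambda>_. 1"] *
    by (simp add: integrable_unit_lborel_bounded[where B = 1] measure_unit_lborel_UNIV)
  ultimately show ?thesis
    using sawtooth_iterated_bound[of a b] False assms by auto
qed

lemma measurable_sawtooth2 [measurable]: "(\<lambda>b. sawtooth2 a b) \<in> borel_measurable borel"
  unfolding sawtooth2_def by (rule borel_measurable_unit_integral) measurable

text \<open>Fubini. The scale c covers both the eigenvalue equation (c = 1) and the equation for
  differences (c = r).\<close>

lemma sawtooth_iterated_integral:
  assumes [measurable]: "g \<in> borel_measurable borel" and G: "\<And>w. \<bar>g w\<bar> \<le> G"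
  shows "(\<integral>v. sawtooth (a * v) * (\<integral>w. sawtooth (c * v * w) * g w \<partial>unit_lborel) \<partial>unit_lborel)
       = (\<integral>w. g w * sawtooth2 a (c * w) \<partial>unit_lborel)"
proof -
  have "(\<integral>v. (\<integral>w. sawtooth (a * v) * (sawtooth (c * v * w) * g w) \<partial>unit_lborel) \<partial>unit_lborel)
      = (\<integral>w. (\<integral>v. sawtooth (a * v) * (sawtooth (c * v * w) * g w) \<partial>unit_lborel) \<partial>unit_lborel)"
  proof (rule unit_lborel_Fubini)
    show "\<bar>sawtooth (a * v) * (sawtooth (c * v * w) * g w)\<bar> \<le> 1/2 * (1/2 * G)" for v w
      unfolding abs_mult by (intro mult_mono sawtooth_bound G) auto
  qed measurable
  also have "\<dots> = (\<integral>w. g w * sawtooth2 a (c * w) \<partial>unit_lborel)"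
    unfolding sawtooth2_def
    by (simp only: integral_mult_right_zero[symmetric]) (simp add: mult_ac)
  finally show ?thesis by simp
qed

text \<open>The source of the factor x (1 + log (1/x)): it is the integral of min 1 (x/w), which
  dominates the iterated kernel. The hypothesis \<open>a \<le> c * x\<close> removes the scale c
  from the quotient a/(cw).\<close>

lemma sawtooth_iterated_integral_bound:
  assumes [measurable]: "g \<in> borel_measurable borel" and G: "\<And>w. \<bar>g w\<bar> \<le> G"
    and a: "0 \<le> a" "a \<le> c * x" and c: "0 < c" "c \<le> 1" and x: "0 < x" "x \<le> 1"
  shows "\<bar>\<integral>v. sawtooth (a * v) * (\<integral>w. sawtooth (c * v * w) * g w \<partial>unit_lborel) \<partial>unit_lborel\<bar>
       \<le> G * (x * (1 + ln (1 / x)))"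
proof -
  have "\<bar>\<integral>w. g w * sawtooth2 a (c * w) \<partial>unit_lborel\<bar> \<le> (\<integral>w. G * min 1 (x / w) \<partial>unit_lborel)"
  proof (rule abs_integral_unit_lborel_le)
    show "integrable unit_lborel (\<lambda>w. G * min 1 (x / w))"
      using integral_min_1_over(1)[OF x] by simp
    fix w :: real assume w: "w \<in> {0..1}"
    have "\<bar>sawtooth2 a (c * w)\<bar> \<le> min 1 (a / (c * w))"
      using w c a by (intro sawtooth2_bound) (auto intro: mult_le_one)
    also have "\<dots> \<le> min 1 (x / w)"
    proof -
      have "a / (c * w) \<le> c * x / (c * w)" using a c w by (intro divide_right_mono) auto
      then show ?thesis using c by auto
    qed
    finally show "\<bar>g w * sawtooth2 a (c * w)\<bar> \<le> G * min 1 (x / w)"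
      unfolding abs_mult using G[of w] by (intro mult_mono) auto
  qed measurable
  also have "\<dots> = G * (x * (1 + ln (1 / x)))"
    using integral_min_1_over[OF x] by simp
  finally show ?thesis by (simp add: sawtooth_iterated_integral[OF assms(1) G])
qed

section \<open>The effect of scaling on the sawtooth in weighted L^1\<close>

lemma integral_unit_powr:
  assumes "0 < \<epsilon>"
  shows "integrable unit_lborel (\<lambda>y. y powr (\<epsilon> - 1))"
    and "(\<integral>y. y powr (\<epsilon> - 1) \<partial>unit_lborel) = 1 / \<epsilon>"
proof -
  have hi: "((\<lambda>y. y powr (\<epsilon> - 1)) has_integral 1 / \<epsilon>) {0..1}"
    using has_integral_powr_from_0[of "\<epsilon> - 1" 1] assms by simp
  then have "(\<lambda>y. y powr (\<epsilon> - 1)) absolutely_integrable_on {0..1}"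
    by (intro nonnegative_absolutely_integrable_1) auto
  then have si: "set_integrable lborel {0..1} (\<lambda>y. y powr (\<epsilon> - 1))"
    by (simp add: set_integrable_def integrable_completion)
  then show "integrable unit_lborel (\<lambda>y. y powr (\<epsilon> - 1))"
    by (simp add: integrable_restrict_space set_integrable_def)
  show "(\<integral>y. y powr (\<epsilon> - 1) \<partial>unit_lborel) = 1 / \<epsilon>"
    using set_borel_integral_eq_integral(2)[OF si] integral_unique[OF hi]
    by (simp add: integral_restrict_space set_lebesgue_integral_def)
qed

text \<open>The difference is the growth of 1/t minus the growth of its floor, both nonnegative.
  Keeping the floors as a signed difference, without absolute values, lets them nearly cancel after
  integration.\<close>

lemma sawtooth_diff_le:
  assumes "0 < r" "r \<le> 1" "0 < t"
  shows "\<bar>sawtooth t - sawtooth (r * t)\<bar>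
     \<le> (1 / r - 1) * (1 / t) + (of_int \<lfloor>1 / (r * t)\<rfloor> - of_int \<lfloor>1 / t\<rfloor>)"
proof -
  have le: "1 / t \<le> 1 / (r * t)" using assms by (auto simp: field_simps)
  have "\<lfloor>1 / t\<rfloor> \<le> \<lfloor>1 / (r * t)\<rfloor>" using le by (rule floor_mono)
  then have "of_int \<lfloor>1 / t\<rfloor> \<le> (of_int \<lfloor>1 / (r * t)\<rfloor> :: real)" by simp
  moreover have "sawtooth t - sawtooth (r * t)
      = (1 / (r * t) - 1 / t) - (of_int \<lfloor>1 / (r * t)\<rfloor> - of_int \<lfloor>1 / t\<rfloor>)"
    using assms by (simp add: sawtooth_def frac_def)
  moreover have "(1 / r - 1) * (1 / t) = 1 / (r * t) - 1 / t"
    using assms by (simp add: field_simps)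
  ultimately show ?thesis using le by linarith
qed

text \<open>The integral of |k(xy) - k(rxy)| is controlled through \<open>sawtooth_diff_le\<close>.
  The weight y^\<epsilon> makes 1/y integrable at the price 1/\<epsilon>, and the two floor terms
  are related by the substitution v = ry.\<close>

lemma sawtooth_scaling_L1:
  assumes x: "0 < x" and r: "1/2 \<le> r" "r < 1" and \<epsilon>: "0 < \<epsilon>" "\<epsilon> \<le> 1"
  shows "integrable unit_lborel (\<lambda>y. \<bar>sawtooth (x * y) - sawtooth (r * x * y)\<bar> * y powr \<epsilon>)"
    and "(\<integral>y. \<bar>sawtooth (x * y) - sawtooth (r * x * y)\<bar> * y powr \<epsilon> \<partial>unit_lborel) \<le> 10 * (1 - r) / (x * \<epsilon>)"
proof -
  define F where "F c y = of_int \<lfloor>1 / (c * y)\<rfloor> * y powr \<epsilon>" for c y :: real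
  have [measurable]: "F c \<in> borel_measurable borel" for c
    unfolding F_def[abs_def] by measurable
  have Fb: "0 \<le> F c y" "F c y \<le> 1 / c * y powr (\<epsilon> - 1)" if "0 < c" "0 \<le> y" for c y
  proof -
    show "0 \<le> F c y" unfolding F_def using that by (intro mult_nonneg_nonneg) auto
    show "F c y \<le> 1 / c * y powr (\<epsilon> - 1)"
    proof (cases "y = 0")
      case False
      then have "F c y \<le> 1 / (c * y) * y powr \<epsilon>"
        unfolding F_def by (intro mult_right_mono of_int_floor_le) auto
      also have "\<dots> = 1 / c * y powr (\<epsilon> - 1)"
        using False that by (simp add: powr_diff)
      finally show ?thesis .
    qed (simp add: F_def)
  qed
  have Fi: "integrable unit_lborel (F c)" if "0 < c" for c
    by (rule Bochner_Integration.integrable_bound[of _ "\<lambda>y. 1 / c * y powr (\<epsilon> - 1)"])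
       (use Fb[OF that] integral_unit_powr(1)[OF \<epsilon>(1)] that in
         \<open>auto simp: space_restrict_space intro!: AE_I2\<close>)
  have FI: "integral\<^sup>L unit_lborel (F x) \<le> 1 / (x * \<epsilon>)"
  proof -
    have "integral\<^sup>L unit_lborel (F x) \<le> (\<integral>y. 1 / x * y powr (\<epsilon> - 1) \<partial>unit_lborel)"
      using Fb[OF x] Fi[OF x] integral_unit_powr(1)[OF \<epsilon>(1)]
      by (intro integral_mono) (auto simp: space_restrict_space)
    then show ?thesis using integral_unit_powr(2)[OF \<epsilon>(1)] by (simp add: mult.commute)
  qed
  have Fnn: "0 \<le> integral\<^sup>L unit_lborel (F x)"
    by (rule integral_nonneg_AE) (auto intro!: AE_I2 simp: space_restrict_space Fb x)
  \<comment> \<open>The substitution maps the integral of \<open>F (r * x)\<close> over [0, 1] to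
    that of \<open>F x\<close> over [0, r], with the factor r^(-1-\<epsilon>); as \<open>F x\<close>
    is nonnegative, [0, r] may be enlarged to [0, 1].\<close>
  have scale: "integral\<^sup>L unit_lborel (F (r * x)) \<le> 1 / r\<^sup>2 * integral\<^sup>L unit_lborel (F x)"
  proof -
    have eq: "integral\<^sup>L unit_lborel (F (r * x)) = (\<integral>y. indicator {0..1} y *\<^sub>R F (r * x) y \<partial>lborel)"
      by (simp add: integral_restrict_space)
    have "(\<integral>v. indicator {0..r} v *\<^sub>R F x v \<partial>lborel) = \<bar>r\<bar> *\<^sub>R (\<integral>y. indicator {0..r} (0 + r * y) *\<^sub>R F x (0 + r * y) \<partial>lborel)"
      using r by (intro lborel_integral_real_affine) auto
    also have "\<dots> = r * (\<integral>y. r powr \<epsilon> * (indicator {0..1} y *\<^sub>R F (r * x) y) \<partial>lborel)"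
      using r by (auto simp: F_def indicator_def mult_ac powr_mult zero_le_mult_iff
          intro!: Bochner_Integration.integral_cong)
    also have "\<dots> = r powr (1 + \<epsilon>) * integral\<^sup>L unit_lborel (F (r * x))"
      using r by (simp add: eq powr_add)
    finally have "r powr (1 + \<epsilon>) * integral\<^sup>L unit_lborel (F (r * x)) = (\<integral>v. indicator {0..r} v *\<^sub>R F x v \<partial>lborel)"
      by simp
    also have "\<dots> \<le> (\<integral>v. indicator {0..1} v *\<^sub>R F x v \<partial>lborel)"
    proof (rule integral_mono)
      show i: "integrable lborel (\<lambda>v. indicator {0..1} v *\<^sub>R F x v)"
        using Fi[OF x] by (simp add: integrable_restrict_space)
      show "integrable lborel (\<lambda>v. indicator {0..r} v *\<^sub>R F x v)"
        by (rule Bochner_Integration.integrable_bound[OF i]) (use r in \<open>auto simp: indicator_def intro!: AE_I2\<close>)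
      show "indicator {0..r} v *\<^sub>R F x v \<le> indicator {0..1} v *\<^sub>R F x v" for v
        using r Fb(1)[OF x, of v] by (auto simp: indicator_def)
    qed
    also have "\<dots> = integral\<^sup>L unit_lborel (F x)"
      by (simp add: integral_restrict_space)
    finally have *: "r powr (1 + \<epsilon>) * integral\<^sup>L unit_lborel (F (r * x)) \<le> integral\<^sup>L unit_lborel (F x)" .
    \<comment> \<open>Since \<epsilon> is at most 1 and r < 1, the exponent 1 + \<epsilon> may be
      replaced by 2, which removes \<epsilon> from the factor.\<close>
    have "r\<^sup>2 = r powr 2" using r by simp
    also have "\<dots> \<le> r powr (1 + \<epsilon>)" using r \<epsilon> by (intro powr_mono') auto
    finally have "r\<^sup>2 * integral\<^sup>L unit_lborel (F (r * x)) \<le> r powr (1 + \<epsilon>) * integral\<^sup>L unit_lborel (F (r * x))"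
      using r x by (intro mult_right_mono integral_nonneg_AE) (auto intro!: AE_I2 simp: space_restrict_space Fb)
    with * have "r\<^sup>2 * integral\<^sup>L unit_lborel (F (r * x)) \<le> integral\<^sup>L unit_lborel (F x)" by linarith
    then show ?thesis using r by (simp add: field_simps)
  qed
  define g where "g y = (1 / r - 1) * (1 / x * y powr (\<epsilon> - 1)) + (F (r * x) y - F x y)" for y
  have gi: "integrable unit_lborel g"
    unfolding g_def using Fi[of x] Fi[of "r * x"] x r integral_unit_powr(1)[OF \<epsilon>(1)] by auto
  have le: "\<bar>sawtooth (x * y) - sawtooth (r * x * y)\<bar> * y powr \<epsilon> \<le> g y" if "y \<in> {0..1}" for y
  proof (cases "y = 0")
    case True
    then show ?thesis by (simp add: g_def F_def)
  next
    case False
    then have y: "y > 0" using that by auto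
    have "\<bar>sawtooth (x * y) - sawtooth (r * (x * y))\<bar> * y powr \<epsilon>
      \<le> ((1 / r - 1) * (1 / (x * y)) + (of_int \<lfloor>1 / (r * (x * y))\<rfloor> - of_int \<lfloor>1 / (x * y)\<rfloor>)) * y powr \<epsilon>"
      using y x r by (intro mult_right_mono sawtooth_diff_le) auto
    also have "\<dots> = g y"
      using y by (simp add: g_def F_def powr_diff field_simps)
    finally show ?thesis by (simp add: mult.assoc)
  qed
  show i: "integrable unit_lborel (\<lambda>y. \<bar>sawtooth (x * y) - sawtooth (r * x * y)\<bar> * y powr \<epsilon>)"
    by (rule Bochner_Integration.integrable_bound[OF gi])
       (use le in \<open>auto simp: space_restrict_space intro!: AE_I2 order_trans[OF _ abs_ge_self]\<close>)
  have "(\<integral>y. \<bar>sawtooth (x * y) - sawtooth (r * x * y)\<bar> * y powr \<epsilon> \<partial>unit_lborel) \<le> integral\<^sup>L unit_lborel g"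
    using le by (intro integral_mono i gi) (auto simp: space_restrict_space)
  also have "\<dots> = (1 / r - 1) * (1 / (x * \<epsilon>)) + (integral\<^sup>L unit_lborel (F (r * x)) - integral\<^sup>L unit_lborel (F x))"
  proof -
    have i0: "integrable unit_lborel (\<lambda>y. (1 / r - 1) * (1 / x * y powr (\<epsilon> - 1)))"
      using integral_unit_powr(1)[OF \<epsilon>(1)] by (intro integrable_mult_right)
    have i1: "integrable unit_lborel (F (r * x))" and i2: "integrable unit_lborel (F x)"
      using x r by (auto intro: Fi)
    have "(\<integral>y. (1 / r - 1) * (1 / x * y powr (\<epsilon> - 1)) \<partial>unit_lborel) = (1 / r - 1) * (1 / (x * \<epsilon>))"
      by (simp only: integral_mult_right_zero integral_unit_powr(2)[OF \<epsilon>(1)]) simp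
    then show ?thesis
      unfolding g_def
      by (simp only: Bochner_Integration.integral_add[OF i0 Bochner_Integration.integrable_diff[OF i1 i2]]
          Bochner_Integration.integral_diff[OF i1 i2])
  qed
  also have "\<dots> \<le> (1 / r - 1) * (1 / (x * \<epsilon>)) + (1 / r\<^sup>2 - 1) * (1 / (x * \<epsilon>))"
  proof -
    have "0 \<le> 1 / r\<^sup>2 - 1" using r by (simp add: power_le_one)
    from mult_left_mono[OF FI this] scale show ?thesis by (simp add: algebra_simps)
  qed
  also have "\<dots> = (1 / r - 1 + (1 / r\<^sup>2 - 1)) * (1 / (x * \<epsilon>))" by (rule distrib_right[symmetric])
  also have "\<dots> \<le> (10 * (1 - r)) * (1 / (x * \<epsilon>))"
  proof (rule mult_right_mono)
    have a: "1 / r \<le> 2" using r by (simp add: field_simps)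
    \<comment> \<open>Factoring out 1 - r and using r at least 1/2 gives the constant 10 = 2 + 2 *
      4.\<close>
    have "1 / r - 1 + (1 / r\<^sup>2 - 1) = (1 - r) * (1 / r + (1 + r) * ((1 / r) * (1 / r)))"
      using r by (simp add: field_simps power2_eq_square)
    also have "\<dots> \<le> (1 - r) * (2 + 2 * (2 * 2))"
      using r a by (intro mult_left_mono add_mono mult_mono) auto
    finally show "1 / r - 1 + (1 / r\<^sup>2 - 1) \<le> 10 * (1 - r)" by simp
  qed (use x \<epsilon> in auto)
  finally show "(\<integral>y. \<bar>sawtooth (x * y) - sawtooth (r * x * y)\<bar> * y powr \<epsilon> \<partial>unit_lborel) \<le> 10 * (1 - r) / (x * \<epsilon>)"
    by simp
qed

text \<open>Applied to the eigenvalue equation, the rescaled part brings in f(rv), whence the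
  difference f(v) - f(rv); the part over (r, 1] becomes the inhomogeneous term.\<close>

lemma unit_integral_split:
  fixes g :: "real \<Rightarrow> real"
  assumes [measurable]: "g \<in> borel_measurable borel" and B: "\<And>x. \<bar>g x\<bar> \<le> B" and r: "0 < r" "r < 1"
  shows "integral\<^sup>L unit_lborel g
       = r * (\<integral>v. g (r * v) \<partial>unit_lborel) + (\<integral>s. indicator {r<..1} s * g s \<partial>unit_lborel)"
proof -
  have i1: "integrable unit_lborel (\<lambda>s. indicator {0..r} s * g s)"
    and i2: "integrable unit_lborel (\<lambda>s. indicator {r<..1} s * g s)"
    using B order_trans[OF abs_ge_zero B]
    by (auto intro!: integrable_unit_lborel_bounded[where B = B] simp: indicator_def)
  have "integral\<^sup>L unit_lborel g = (\<integral>s. indicator {0..r} s * g s + indicator {r<..1} s * g s \<partial>unit_lborel)"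
    by (rule Bochner_Integration.integral_cong) (auto simp: space_restrict_space indicator_def)
  also have "\<dots> = (\<integral>s. indicator {0..r} s * g s \<partial>unit_lborel) + (\<integral>s. indicator {r<..1} s * g s \<partial>unit_lborel)"
    by (rule Bochner_Integration.integral_add[OF i1 i2])
  also have "(\<integral>s. indicator {0..r} s * g s \<partial>unit_lborel) = (\<integral>s. indicator {0..r} s * g s \<partial>lborel)"
    using r by (auto simp: integral_restrict_space indicator_def intro!: Bochner_Integration.integral_cong)
  also have "\<dots> = \<bar>r\<bar> *\<^sub>R (\<integral>v. indicator {0..r} (0 + r * v) * g (0 + r * v) \<partial>lborel)"
    using r by (intro lborel_integral_real_affine) auto
  also have "\<dots> = r * (\<integral>v. g (r * v) \<partial>unit_lborel)"
    using r by (auto simp: integral_restrict_space indicator_def zero_le_mult_iff intro!: Bochner_Integration.integral_cong)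
  finally show ?thesis .
qed

section \<open>Subintervals, elementary inequalities and limits from the left\<close>

lemma integral_unit_indicator:
  assumes "0 \<le> r" "r \<le> 1"
  shows "(\<integral>s. indicator {0..r} s \<partial>unit_lborel) = r" "(\<integral>s. indicator {r<..1} s \<partial>unit_lborel) = 1 - r"
proof -
  have "{0..r} \<inter> {0..1} = {0..r}" "{r<..1} \<inter> {0..1} = {r<..1}" using assms by auto
  moreover have "measure unit_lborel {0..r} = r" "measure unit_lborel {r<..1} = 1 - r"
    using assms by (subst measure_restrict_space; auto)+
  ultimately show "(\<integral>s. indicator {0..r} s \<partial>unit_lborel) = r" "(\<integral>s. indicator {r<..1} s \<partial>unit_lborel) = 1 - r"
    using assms by (simp_all add: space_restrict_space min_absorb1)
qed

text \<open>With q = sqrt x this is ln (1/q) \<le> 1/q - 1, doubled.\<close>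

lemma x_ln_le_sqrt:
  assumes "0 < x"
  shows "x * (1 + ln (1 / x)) \<le> 2 * sqrt x"
proof -
  define q where "q = sqrt x"
  have q: "q > 0" "x = q * q" using assms by (auto simp: q_def)
  have "ln (1 / q) \<le> 1 / q - 1" using q by (intro ln_le_minus_one) auto
  then have "1 + ln (1 / x) \<le> 2 / q" using q by (simp add: ln_div ln_mult)
  then have "q * q * (1 + ln (1 / x)) \<le> q * q * (2 / q)" using q by (intro mult_left_mono) auto
  then show ?thesis using q by (simp add: q_def[symmetric])
qed

text \<open>s^\<epsilon> is a weighted geometric mean of 1 and sqrt s, hence not below the smaller
  one.\<close>

lemma min_1_sqrt_le_powr:
  assumes "0 < s" "0 \<le> \<epsilon>" "\<epsilon> \<le> 1/2"
  shows "min 1 (sqrt s) \<le> s powr \<epsilon>"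
proof (cases "s \<ge> 1")
  case True
  then have "1 \<le> s powr \<epsilon>" using assms by (intro ge_one_powr_ge_zero) auto
  then show ?thesis by simp
next
  case False
  then have "s powr (1/2) \<le> s powr \<epsilon>" using assms by (intro powr_mono') auto
  then show ?thesis using assms by (simp add: powr_half_sqrt)
qed

text \<open>Keeps the exponent 1/(4 ln A) at most 1/2 and allows constants to be absorbed into
  powers of ln A.\<close>

lemma half_le_ln: "2 \<le> (A::real) \<Longrightarrow> 1/2 \<le> ln A"
  using ln2_ge_two_thirds ln_mono[of 2 A] by linarith

text \<open>As s increases to 1, 1/(xs) decreases to 1/x, and the floor is continuous from the
  right. Hence the limit is correct even when 1/x is an integer.\<close>

lemma sawtooth_left_continuous:
  assumes x: "0 < x"
  shows "((\<lambda>s. sawtooth (x * s)) \<longlongrightarrow> sawtooth x) (at_left 1)"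
proof -
  define n where "n = \<lfloor>1 / x\<rfloor>"
  have n: "of_int n \<le> 1 / x" "1 / x < of_int n + 1" unfolding n_def by linarith+
  have t: "((\<lambda>s. 1 / (x * s)) \<longlongrightarrow> 1 / x) (at_left 1)"
    using x by (auto intro!: tendsto_eq_intros)
  have e1: "eventually (\<lambda>s. 1 / (x * s) < of_int n + 1) (at_left 1)"
    using order_tendstoD(2)[OF t n(2)] .
  have e2: "eventually (\<lambda>s::real. s \<in> {0<..<1}) (at_left 1)"
    by (rule eventually_at_left_real) simp
  have "eventually (\<lambda>s. 1/2 - (1 / (x * s) - of_int n) = sawtooth (x * s)) (at_left 1)"
    using e1 e2
  proof eventually_elim
    case (elim s)
    have "1 / x \<le> 1 / (x * s)" using elim x by (auto simp: field_simps)
    then have "\<lfloor>1 / (x * s)\<rfloor> = n" using n elim by (intro floor_unique) auto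
    then show ?case using elim x by (simp add: sawtooth_def frac_def)
  qed
  moreover have "((\<lambda>s. 1/2 - (1 / (x * s) - of_int n)) \<longlongrightarrow> 1/2 - (1 / x - of_int n)) (at_left 1)"
    by (intro tendsto_intros t)
  moreover have "1/2 - (1 / x - of_int n) = sawtooth x"
    using x by (simp add: sawtooth_def frac_def n_def)
  ultimately show ?thesis by (auto intro: Lim_transform_eventually)
qed

text \<open>Identifies the limit of the inhomogeneous term divided by 1 - r. Because the left limit
  is assumed to be \<open>h 1\<close>, the endpoint included in \<open>{r<..1}\<close> obeys the
  same estimate.\<close>

lemma average_tendsto_left_limit:
  fixes h :: "real \<Rightarrow> real"
  assumes [measurable]: "h \<in> borel_measurable borel" and B: "\<And>s. \<bar>h s\<bar> \<le> B"
    and lim: "(h \<longlongrightarrow> h 1) (at_left 1)"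
  shows "((\<lambda>r. (\<integral>s. indicator {r<..1} s * h s \<partial>unit_lborel) / (1 - r)) \<longlongrightarrow> h 1) (at_left 1)"
proof (rule tendstoI)
  fix e :: real assume e: "e > 0"
  have "eventually (\<lambda>s. dist (h s) (h 1) < e / 2) (at_left 1)"
    using tendstoD[OF lim, of "e / 2"] e by simp
  then obtain b where b: "b < 1" "\<And>s. b < s \<Longrightarrow> s < 1 \<Longrightarrow> dist (h s) (h 1) < e / 2"
    by (auto simp: eventually_at_left_field)
  have near: "\<bar>h s - h 1\<bar> \<le> e / 2" if "b < s" "s \<le> 1" for s
    using b(2)[of s] that e by (cases "s = 1") (auto simp: dist_real_def)
  have "eventually (\<lambda>r. r \<in> {max b 0<..<1}) (at_left 1)"
    using b by (intro eventually_at_left_real) auto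
  then show "eventually (\<lambda>r. dist ((\<integral>s. indicator {r<..1} s * h s \<partial>unit_lborel) / (1 - r)) (h 1) < e) (at_left 1)"
  proof eventually_elim
    case (elim r)
    then have r: "b < r" "0 < r" "r < 1" by auto
    have i: "integrable unit_lborel (\<lambda>s. indicator {r<..1} s * h s)"
      using B order_trans[OF abs_ge_zero B]
      by (intro integrable_unit_lborel_bounded[where B = B]) (auto simp: indicator_def)
    have ii: "integrable unit_lborel (\<lambda>s. c * indicator {r<..1} s)" for c :: real
      by (rule integrable_unit_lborel_bounded[where B = "\<bar>c\<bar>"]) (auto simp: indicator_def)
    have ic: "(\<integral>s. c * indicator {r<..1} s \<partial>unit_lborel) = c * (1 - r)" for c :: real
      using integral_unit_indicator(2)[of r] r by (simp only: integral_mult_right_zero)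
    have "(\<integral>s. indicator {r<..1} s * h s \<partial>unit_lborel) - h 1 * (1 - r)
       = (\<integral>s. indicator {r<..1} s * h s - h 1 * indicator {r<..1} s \<partial>unit_lborel)"
      by (simp only: Bochner_Integration.integral_diff[OF i ii] ic)
    also have "\<bar>\<dots>\<bar> \<le> (\<integral>s. e / 2 * indicator {r<..1} s \<partial>unit_lborel)"
      by (rule abs_integral_unit_lborel_le[OF _ ii]) (use near r in \<open>auto simp: indicator_def\<close>)
    also have "\<dots> = e / 2 * (1 - r)" by (rule ic)
    finally have "\<bar>(\<integral>s. indicator {r<..1} s * h s \<partial>unit_lborel) - h 1 * (1 - r)\<bar> / (1 - r) \<le> e / 2"
      using r by (simp add: field_simps)
    also have "\<bar>(\<integral>s. indicator {r<..1} s * h s \<partial>unit_lborel) - h 1 * (1 - r)\<bar> / (1 - r)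
       = \<bar>((\<integral>s. indicator {r<..1} s * h s \<partial>unit_lborel) - h 1 * (1 - r)) / (1 - r)\<bar>"
      using r by simp
    also have "((\<integral>s. indicator {r<..1} s * h s \<partial>unit_lborel) - h 1 * (1 - r)) / (1 - r)
       = (\<integral>s. indicator {r<..1} s * h s \<partial>unit_lborel) / (1 - r) - h 1"
      using r by (simp add: diff_divide_distrib)
    finally show ?case using e by (simp add: dist_real_def)
  qed
qed

section \<open>Eigenfunctions\<close>

text \<open>What is retained of a normalised eigenfunction after passing to a Borel function. The
  bounds |\<lambda>|/2 and 2 both stem from |K| \<le> 1/2 and norm one; the first holds on the whole
  line because f will be extended by zero.\<close>

locale bounded_eigenfunction =
  fixes f :: "real \<Rightarrow> real" and lam :: real
  assumes f_measurable [measurable]: "f \<in> borel_measurable borel"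
    and f_bound: "\<bar>f x\<bar> \<le> \<bar>lam\<bar> / 2"
    and lam_ge: "2 \<le> \<bar>lam\<bar>"
    and eigen: "x \<in> {0..1} \<Longrightarrow> f x = lam * (\<integral>y. sawtooth (x * y) * f y \<partial>unit_lborel)"
begin

abbreviation A :: real where "A \<equiv> \<bar>lam\<bar>"

section \<open>Decay of an eigenfunction at 0\<close>

lemma f_0: "f 0 = 0"
  using eigen[of 0] by (simp add: sawtooth_def)

lemma sawtooth_f_bound: "\<bar>sawtooth t * f y\<bar> \<le> 1/2 * (A / 2)"
  unfolding abs_mult by (intro mult_mono sawtooth_bound f_bound) auto

text \<open>The eigenvalue equation inserted into itself gives A^2 times an integral against the
  iterated kernel, and \<open>f_bound\<close> supplies A/2. Stating the bound at x for every y up to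
  x allows y = rx without monotonicity of the right-hand side.\<close>

lemma f_decay:
  assumes "0 \<le> y" "y \<le> x" "0 < x" "x \<le> 1"
  shows "\<bar>f y\<bar> \<le> A ^ 3 / 2 * (x * (1 + ln (1 / x)))"
proof -
  have "f y = lam * (\<integral>v. sawtooth (y * v) * f v \<partial>unit_lborel)"
    using assms by (intro eigen) auto
  also have "(\<integral>v. sawtooth (y * v) * f v \<partial>unit_lborel)
      = (\<integral>v. lam * (sawtooth (y * v) * (\<integral>w. sawtooth (1 * v * w) * f w \<partial>unit_lborel)) \<partial>unit_lborel)"
  proof (rule Bochner_Integration.integral_cong[OF refl])
    fix v assume "v \<in> space unit_lborel"
    then have "f v = lam * (\<integral>w. sawtooth (1 * v * w) * f w \<partial>unit_lborel)"
      using eigen[of v] by (simp add: space_restrict_space)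
    then show "sawtooth (y * v) * f v = lam * (sawtooth (y * v) * (\<integral>w. sawtooth (1 * v * w) * f w \<partial>unit_lborel))"
      by simp
  qed
  also have "\<dots> = lam * (\<integral>v. sawtooth (y * v) * (\<integral>w. sawtooth (1 * v * w) * f w \<partial>unit_lborel) \<partial>unit_lborel)"
    by (rule integral_mult_right_zero)
  finally have "\<bar>f y\<bar> = A * (A * \<bar>\<integral>v. sawtooth (y * v) * (\<integral>w. sawtooth (1 * v * w) * f w \<partial>unit_lborel) \<partial>unit_lborel\<bar>)"
    by (simp add: abs_mult)
  also have "\<dots> \<le> A * (A * (A / 2 * (x * (1 + ln (1 / x)))))"
    using assms by (intro mult_left_mono sawtooth_iterated_integral_bound f_bound) auto
  finally show ?thesis by (simp add: power3_eq_cube)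
qed

lemma f_le_sqrt:
  assumes "0 < x" "x \<le> 1"
  shows "\<bar>f x\<bar> \<le> A ^ 3 * sqrt x"
proof -
  have "\<bar>f x\<bar> \<le> A ^ 3 / 2 * (x * (1 + ln (1 / x)))" using assms by (intro f_decay) auto
  also have "\<dots> \<le> A ^ 3 / 2 * (2 * sqrt x)" using assms by (intro mult_left_mono x_ln_le_sqrt) auto
  finally show ?thesis by simp
qed

text \<open>The exponent interpolates between the bounded and the square-root estimate; it is chosen so that
  the power of \<open>A\<close> in the constant collapses to \<open>e\<close>.\<close>

lemma f_le_powr:
  assumes "0 \<le> y" "y \<le> 1"
  shows "\<bar>f y\<bar> \<le> 3 * A * y powr (1 / (4 * ln A))"
proof (cases "y = 0")
  case False
  then have y: "0 < y" using assms by auto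
  define \<epsilon> where "\<epsilon> = 1 / (4 * ln A)"
  have lnA: "1/2 \<le> ln A" by (rule half_le_ln[OF lam_ge])
  have \<epsilon>: "0 \<le> \<epsilon>" "\<epsilon> \<le> 1/2" using lnA by (auto simp: \<epsilon>_def field_simps)
  have "sqrt (A ^ 4 * y) = A ^ 2 * sqrt y"
  proof -
    have "sqrt (A ^ 4) = A ^ 2" by (rule real_sqrt_unique) (auto simp flip: power_mult)
    then show ?thesis by (simp only: real_sqrt_mult)
  qed
  then have "\<bar>f y\<bar> \<le> A * sqrt (A ^ 4 * y)"
    using f_le_sqrt[OF y assms(2)] by (simp add: power_numeral_reduce mult_ac)
  moreover have "\<bar>f y\<bar> \<le> A * 1" using f_bound[of y] by simp
  ultimately have "\<bar>f y\<bar> \<le> A * min 1 (sqrt (A ^ 4 * y))" by (simp add: min_def)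
  also have "\<dots> \<le> A * (A ^ 4 * y) powr \<epsilon>"
    using y \<epsilon> lam_ge by (intro mult_left_mono min_1_sqrt_le_powr) auto
  also have "(A ^ 4 * y) powr \<epsilon> = (A ^ 4) powr \<epsilon> * y powr \<epsilon>"
    using y by (simp add: powr_mult)
  also have "(A ^ 4) powr \<epsilon> = exp 1"
  proof -
    have "ln (A ^ 4) = 4 * ln A" by (subst ln_realpow) (use lam_ge in auto)
    moreover have "\<epsilon> * (4 * ln A) = 1" using lnA by (simp add: \<epsilon>_def)
    moreover have "A ^ 4 \<noteq> 0" using lam_ge by auto
    ultimately show ?thesis by (simp only: powr_def if_False)
  qed
  also have "A * (exp 1 * y powr \<epsilon>) \<le> A * (3 * y powr \<epsilon>)"
    using exp_le by (intro mult_left_mono mult_right_mono) auto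
  finally show ?thesis by (simp add: \<epsilon>_def)
qed (simp add: f_0)

section \<open>Differences of an eigenfunction under scaling\<close>

lemma sawtooth_f_integrable: "integrable unit_lborel (\<lambda>y. sawtooth (c * y) * f y)"
  by (rule integrable_unit_lborel_bounded[OF _ sawtooth_f_bound]) measurable

text \<open>The scaling acts on the kernel alone, and the power bound \<open>f_le_powr\<close>
  provides the weight for \<open>sawtooth_scaling_L1\<close>.\<close>

lemma f_diff_bound_over_x:
  assumes x: "0 < x" "x \<le> 1" and r: "1/2 \<le> r" "r < 1"
  shows "\<bar>f x - f (r * x)\<bar> \<le> (1 - r) * (120 * A\<^sup>2 * ln A / x)"
proof -
  define \<epsilon> where "\<epsilon> = 1 / (4 * ln A)"
  have lnA: "1/2 \<le> ln A" by (rule half_le_ln[OF lam_ge])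
  have \<epsilon>: "0 < \<epsilon>" "\<epsilon> \<le> 1" using lnA by (auto simp: \<epsilon>_def field_simps)
  have "r * x \<le> 1" using x r by (auto intro: mult_le_one)
  then have "f x - f (r * x) = lam * (\<integral>y. sawtooth (x * y) * f y \<partial>unit_lborel) - lam * (\<integral>y. sawtooth (r * x * y) * f y \<partial>unit_lborel)"
    using eigen[of x] eigen[of "r * x"] x r by simp
  also have "\<dots> = lam * ((\<integral>y. sawtooth (x * y) * f y \<partial>unit_lborel) - (\<integral>y. sawtooth (r * x * y) * f y \<partial>unit_lborel))"
    by (simp add: algebra_simps)
  also have "\<dots> = lam * (\<integral>y. sawtooth (x * y) * f y - sawtooth (r * x * y) * f y \<partial>unit_lborel)"
    by (simp only: Bochner_Integration.integral_diff[OF sawtooth_f_integrable sawtooth_f_integrable])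
  finally have eq: "\<bar>f x - f (r * x)\<bar> = A * \<bar>\<integral>y. sawtooth (x * y) * f y - sawtooth (r * x * y) * f y \<partial>unit_lborel\<bar>"
    by (simp add: abs_mult)
  have "\<bar>\<integral>y. sawtooth (x * y) * f y - sawtooth (r * x * y) * f y \<partial>unit_lborel\<bar>
     \<le> (\<integral>y. 3 * A * (\<bar>sawtooth (x * y) - sawtooth (r * x * y)\<bar> * y powr \<epsilon>) \<partial>unit_lborel)"
  proof (rule abs_integral_unit_lborel_le)
    show "integrable unit_lborel (\<lambda>y. 3 * A * (\<bar>sawtooth (x * y) - sawtooth (r * x * y)\<bar> * y powr \<epsilon>))"
      using sawtooth_scaling_L1(1)[OF x(1) r \<epsilon>] by simp
    fix y :: real assume "y \<in> {0..1}"
    then have "\<bar>f y\<bar> \<le> 3 * A * y powr \<epsilon>" using f_le_powr[of y] by (simp add: \<epsilon>_def)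
    then have "\<bar>sawtooth (x * y) - sawtooth (r * x * y)\<bar> * \<bar>f y\<bar>
       \<le> \<bar>sawtooth (x * y) - sawtooth (r * x * y)\<bar> * (3 * A * y powr \<epsilon>)"
      by (intro mult_left_mono) auto
    then show "\<bar>sawtooth (x * y) * f y - sawtooth (r * x * y) * f y\<bar>
       \<le> 3 * A * (\<bar>sawtooth (x * y) - sawtooth (r * x * y)\<bar> * y powr \<epsilon>)"
      unfolding left_diff_distrib[symmetric] abs_mult by (simp only: mult_ac)
  qed measurable
  also have "\<dots> \<le> 3 * A * (10 * (1 - r) / (x * \<epsilon>))"
    using sawtooth_scaling_L1(2)[OF x(1) r \<epsilon>]
    unfolding integral_mult_right_zero by (intro mult_left_mono) auto
  finally have "\<bar>f x - f (r * x)\<bar> \<le> A * (3 * A * (10 * (1 - r) / (x * \<epsilon>)))"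
    unfolding eq by (intro mult_left_mono) auto
  \<comment> \<open>120 = 3 * 10 * 4, the 4 and the logarithm coming from 1/\<epsilon> = 4 ln
    A.\<close>
  also have "\<dots> = (1 - r) * (120 * A\<^sup>2 * ln A / x)"
  proof -
    have "a * (3 * a * (10 * (1 - r) / (x * \<epsilon>))) = (1 - r) * (120 * a\<^sup>2 * ln A / x)" for a
      using x lnA by (simp add: \<epsilon>_def power2_eq_square field_simps)
    then show ?thesis .
  qed
  finally show ?thesis .
qed

text \<open>The truncation lets \<open>diff_bound\<close> hold for every real argument, as
  \<open>sawtooth_iterated_integral_bound\<close> demands, although the eigenvalue equation is
  available on [0, 1] only.\<close>

definition diff :: "real \<Rightarrow> real \<Rightarrow> real" where
  "diff r v = indicator {0..1} v * (f v - f (r * v))"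

lemma diff_measurable [measurable]: "diff r \<in> borel_measurable borel"
  unfolding diff_def[abs_def] by measurable

lemma diff_bound_trivial: "\<bar>diff r v\<bar> \<le> A"
  using f_bound[of v] f_bound[of "r * v"] by (auto simp: diff_def indicator_def abs_le_iff)

text \<open>Splitting the equation for f(x) at r gives \<lambda>r \<integral> k(rxv) f(rv) dv plus
  the part over (r, 1], while r f(rx) = \<lambda>r \<integral> k(rxv) f(v) dv. Subtracting explains
  the minus sign; the term -(1 - r) f(x) corrects f(x) - r f(rx) to r (f(x) - f(rx)).\<close>

lemma diff_equation:
  assumes x: "x \<in> {0..1}" and r: "0 < r" "r < 1"
  shows "r * diff r x = - (1 - r) * f x - lam * (r * (\<integral>v. sawtooth (r * x * v) * diff r v \<partial>unit_lborel))
      + lam * (\<integral>s. indicator {r<..1} s * (sawtooth (x * s) * f s) \<partial>unit_lborel)"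
proof -
  have rx: "r * x \<in> {0..1}" using x r by (auto intro: mult_le_one)
  have i: "integrable unit_lborel (\<lambda>v. sawtooth (r * x * v) * f (r * v))"
    by (rule integrable_unit_lborel_bounded[OF _ sawtooth_f_bound]) measurable
  have "f x = lam * (\<integral>y. sawtooth (x * y) * f y \<partial>unit_lborel)"
    by (rule eigen[OF x])
  also have "(\<integral>y. sawtooth (x * y) * f y \<partial>unit_lborel)
     = r * (\<integral>v. sawtooth (x * (r * v)) * f (r * v) \<partial>unit_lborel)
       + (\<integral>s. indicator {r<..1} s * (sawtooth (x * s) * f s) \<partial>unit_lborel)"
    by (rule unit_integral_split[OF _ sawtooth_f_bound r]) measurable
  finally have fx: "f x = lam * (r * (\<integral>v. sawtooth (r * x * v) * f (r * v) \<partial>unit_lborel))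
       + lam * (\<integral>s. indicator {r<..1} s * (sawtooth (x * s) * f s) \<partial>unit_lborel)"
    by (simp add: algebra_simps)
  have "(\<integral>v. sawtooth (r * x * v) * diff r v \<partial>unit_lborel)
     = (\<integral>v. sawtooth (r * x * v) * f v - sawtooth (r * x * v) * f (r * v) \<partial>unit_lborel)"
    by (rule Bochner_Integration.integral_cong) (auto simp: space_restrict_space diff_def algebra_simps)
  also have "\<dots> = (\<integral>v. sawtooth (r * x * v) * f v \<partial>unit_lborel) - (\<integral>v. sawtooth (r * x * v) * f (r * v) \<partial>unit_lborel)"
    by (rule Bochner_Integration.integral_diff[OF sawtooth_f_integrable i])
  finally have d: "(\<integral>v. sawtooth (r * x * v) * diff r v \<partial>unit_lborel) = \<dots>" .
  have "r * diff r x = - (1 - r) * f x + (f x - r * f (r * x))"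
    using x by (simp add: diff_def algebra_simps)
  then show ?thesis
    unfolding d using fx eigen[OF rx] by (simp add: algebra_simps)
qed

text \<open>364 = 3 * 120 + 4: the crude bound integrated over large arguments gives 360, and 4
  absorbs 2A + A^2.\<close>

definition M :: real where "M = 364 * A ^ 3 * (ln A)\<^sup>2"

text \<open>Small arguments are absorbed into half of the supremum of the difference; for the others the
  weaker bound by a multiple of \<open>1/v\<close> suffices.\<close>

lemma diff_bound:
  assumes r: "1/2 \<le> r" "r < 1"
  shows "\<bar>diff r x\<bar> \<le> (1 - r) * M"
proof -
  define B where "B = 120 * A\<^sup>2 * ln A"
  define m where "m = (SUP x. \<bar>diff r x\<bar>)"
  have lnA: "1/2 \<le> ln A" by (rule half_le_ln[OF lam_ge])
  have B0: "0 \<le> B" using lnA by (simp add: B_def)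
  have bdd: "bdd_above (range (\<lambda>x. \<bar>diff r x\<bar>))"
    using diff_bound_trivial by (intro bdd_aboveI[where M = A]) auto
  have m: "\<bar>diff r x\<bar> \<le> m" for x
    unfolding m_def by (rule cSUP_upper[OF _ bdd]) simp
  have m0: "0 \<le> m" using m[of 0] by simp
  have A1: "0 < 1 / A" "1 / A \<le> 1" using lam_ge by (auto simp: field_simps)
  \<comment> \<open>The cut at 1/A contributes m/A, which the factor A and the kernel bound 1/2 turn
    into m/2. Beyond the cut, the second summand is just (1 - r) B/v, written so that
    \<open>integral_min_1_over\<close> applies.\<close>
  define h where "h v = m * indicator {0..1 / A} v + ((1 - r) * B * A) * min 1 ((1 / A) / v)" for v :: real
  have hi: "integrable unit_lborel h"
    unfolding h_def using integral_min_1_over(1)[OF A1] m0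
    by (intro Bochner_Integration.integrable_add integrable_mult_right
        integrable_unit_lborel_bounded[where B = 1 and f = "indicator {0..1 / A}"]) auto
  have dh: "\<bar>diff r v\<bar> \<le> h v" if v: "v \<in> {0..1}" for v
  proof (cases "v \<le> 1 / A")
    case True
    then show ?thesis using v m[of v] r B0 by (simp add: h_def add_increasing2)
  next
    case False
    then have v0: "0 < v" "1 / A < v" using A1 by linarith+
    have "\<bar>diff r v\<bar> \<le> (1 - r) * (B / v)"
      using f_diff_bound_over_x[OF v0(1) _ r] v by (simp add: diff_def B_def)
    also have "\<dots> = h v"
      using v0 lam_ge by (simp add: h_def min_def field_simps)
    finally show ?thesis .
  qed
  have "integral\<^sup>L unit_lborel h = m * (1 / A) + ((1 - r) * B * A) * (1 / A * (1 + ln A))"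
    unfolding h_def using integral_min_1_over[OF A1] integral_unit_indicator(1)[of "1 / A"] A1
      integrable_unit_lborel_bounded[where B = 1 and f = "indicator {0..1 / A}"]
    by (subst Bochner_Integration.integral_add) auto
  also have "\<dots> = m / A + (1 - r) * B * (1 + ln A)"
    using lam_ge by simp
  also have "\<dots> \<le> m / A + (1 - r) * B * (3 * ln A)"
    using lnA r B0 by (intro add_left_mono mult_left_mono) auto
  finally have hI: "integral\<^sup>L unit_lborel h \<le> m / A + (1 - r) * B * (3 * ln A)" .
  have T: "\<bar>\<integral>v. sawtooth (r * x * v) * diff r v \<partial>unit_lborel\<bar> \<le> 1/2 * (m / A + (1 - r) * B * (3 * ln A))" for x
  proof -
    have "\<bar>\<integral>v. sawtooth (r * x * v) * diff r v \<partial>unit_lborel\<bar> \<le> (\<integral>v. 1/2 * h v \<partial>unit_lborel)"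
    proof (rule abs_integral_unit_lborel_le)
      show "\<bar>sawtooth (r * x * v) * diff r v\<bar> \<le> 1/2 * h v" if "v \<in> {0..1}" for v
        unfolding abs_mult by (intro mult_mono sawtooth_bound dh that) auto
    qed (use hi in auto)
    also have "\<dots> \<le> 1/2 * (m / A + (1 - r) * B * (3 * ln A))"
      using hI by simp
    finally show ?thesis .
  qed
  have S: "\<bar>\<integral>s. indicator {r<..1} s * (sawtooth (x * s) * f s) \<partial>unit_lborel\<bar> \<le> A / 4 * (1 - r)" for x
  proof -
    have "\<bar>\<integral>s. indicator {r<..1} s * (sawtooth (x * s) * f s) \<partial>unit_lborel\<bar>
       \<le> (\<integral>s. A / 4 * indicator {r<..1} s \<partial>unit_lborel)"
    proof (rule abs_integral_unit_lborel_le)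
      show "integrable unit_lborel (\<lambda>s. A / 4 * indicator {r<..1} s)"
        by (rule integrable_unit_lborel_bounded[where B = "A / 4"]) (auto simp: indicator_def)
      show "\<bar>indicator {r<..1} s * (sawtooth (x * s) * f s)\<bar> \<le> A / 4 * indicator {r<..1} s" for s
        using sawtooth_f_bound[of "x * s" s] by (auto simp: indicator_def)
    qed measurable
    also have "\<dots> = A / 4 * (1 - r)"
      using integral_unit_indicator(2)[of r] r by simp
    finally show ?thesis .
  qed
  have arith: "2 * A + A\<^sup>2 + 3 * A * B * ln A \<le> M"
  proof -
    have "2 * A \<le> A * A" using lam_ge by (intro mult_right_mono) auto
    then have a: "2 * A + A\<^sup>2 \<le> 2 * A\<^sup>2" by (simp add: power2_eq_square)
    have "2 * A\<^sup>2 \<le> A * A\<^sup>2" using lam_ge by (intro mult_right_mono) auto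
    then have b: "2 * A\<^sup>2 \<le> A ^ 3" by (simp add: power3_eq_cube power2_eq_square)
    have "1/2 * (1/2) \<le> ln A * ln A" using lnA by (intro mult_mono) auto
    then have "A ^ 3 * 1 \<le> A ^ 3 * (4 * (ln A)\<^sup>2)"
      by (intro mult_left_mono) (auto simp: power2_eq_square)
    then have "A ^ 3 \<le> 4 * (A ^ 3 * (ln A)\<^sup>2)" by simp
    moreover have "3 * A * B * ln A = 360 * (A ^ 3 * (ln A)\<^sup>2)"
      by (simp add: B_def power2_eq_square power3_eq_cube)
    moreover have "M = 364 * (A ^ 3 * (ln A)\<^sup>2)" by (simp add: M_def)
    ultimately show ?thesis using a b by linarith
  qed
  have "\<bar>diff r x\<bar> \<le> (1 - r) * M / 2 + m / 2" for x
  proof (cases "x \<in> {0..1}")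
    case False
    then show ?thesis using m0 r by (simp add: diff_def M_def)
  next
    case True
    have "r * \<bar>diff r x\<bar> = \<bar>r * diff r x\<bar>" using r by (simp add: abs_mult)
    also have "\<dots> \<le> \<bar>- (1 - r) * f x\<bar> + \<bar>lam * (r * (\<integral>v. sawtooth (r * x * v) * diff r v \<partial>unit_lborel))\<bar>
        + \<bar>lam * (\<integral>s. indicator {r<..1} s * (sawtooth (x * s) * f s) \<partial>unit_lborel)\<bar>"
    proof -
      have r': "0 < r" using r by simp
      show ?thesis unfolding diff_equation[OF True r' r(2)]
        by (rule order_trans[OF abs_triangle_ineq add_mono[OF abs_triangle_ineq4 order_refl]])
    qed
    also have "\<dots> \<le> (1 - r) * (A / 2) + A * (r * (1/2 * (m / A + (1 - r) * B * (3 * ln A)))) + A * (A / 4 * (1 - r))"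
      unfolding abs_mult using r by (intro add_mono mult_mono f_bound T S) auto
    also have "\<dots> = r * (m / 2) + ((1 - r) * (A / 2 + A\<^sup>2 / 4) + r * ((1 - r) * (3 * A * B * ln A) / 2))"
      using lam_ge by (simp add: field_simps power2_eq_square)
    \<comment> \<open>Since r is at least 1/2, the factor 1 is at most 2r; now r can be cancelled on
      both sides.\<close>
    also have "\<dots> \<le> r * (m / 2) + (r * 2 * ((1 - r) * (A / 2 + A\<^sup>2 / 4)) + r * ((1 - r) * (3 * A * B * ln A) / 2))"
      using r mult_right_mono[of 1 "r * 2" "(1 - r) * (A / 2 + A\<^sup>2 / 4)"] by simp
    also have "\<dots> = r * ((1 - r) * (2 * A + A\<^sup>2 + 3 * A * B * ln A) / 2 + m / 2)"
      by (simp add: field_simps)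
    also have "\<dots> \<le> r * ((1 - r) * M / 2 + m / 2)"
      using r arith by (intro mult_left_mono add_right_mono divide_right_mono) auto
    finally show ?thesis using r by simp
  qed
  \<comment> \<open>Passing to the supremum, which is finite by \<open>diff_bound_trivial\<close>,
    allows m/2 to be absorbed.\<close>
  then have "m \<le> (1 - r) * M / 2 + m / 2"
    unfolding m_def by (intro cSUP_least) auto
  then show ?thesis using m[of x] by simp
qed

text \<open>At x = 1 the difference is f(1) - f(r), so \<open>diff_bound\<close> is a Lipschitz
  bound there.\<close>

lemma f_left_continuous_1: "(f \<longlongrightarrow> f 1) (at_left 1)"
proof -
  have "((\<lambda>r. f r - f 1) \<longlongrightarrow> 0) (at_left 1)"
  proof (rule Lim_null_comparison)
    have "eventually (\<lambda>r. r \<in> {1/2<..<1::real}) (at_left 1)"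
      by (rule eventually_at_left_real) simp
    then show "eventually (\<lambda>r. norm (f r - f 1) \<le> (1 - r) * M) (at_left 1)"
    proof eventually_elim
      case (elim r)
      then show ?case using diff_bound[of r 1] by (auto simp: diff_def abs_minus_commute)
    qed
    show "((\<lambda>r. (1 - r) * M) \<longlongrightarrow> 0) (at_left 1)"
      by (auto intro!: tendsto_eq_intros)
  qed
  then show ?thesis by (simp add: Lim_null[symmetric])
qed

text \<open>Bounding the integral directly by \<open>diff_bound\<close> would lose the decay in x.
  Replacing \<open>r * diff r v\<close> by \<open>diff_equation\<close> yields one eigenvalue
  integral and two against the iterated kernel, with shares A^2/2, AM and A^2/2.\<close>

lemma sawtooth_diff_integral_bound:
  assumes x: "0 < x" "x \<le> 1" and r: "1/2 \<le> r" "r < 1"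
  shows "\<bar>r * (\<integral>v. sawtooth (r * x * v) * diff r v \<partial>unit_lborel)\<bar>
     \<le> (1 - r) * ((A\<^sup>2 + A * M) * (x * (1 + ln (1 / x))))"
proof -
  define L where "L = x * (1 + ln (1 / x))"
  have xL: "x * 1 \<le> L" unfolding L_def using x by (intro mult_left_mono) auto
  \<comment> \<open>Moving the cut-off from the kernel to f gives the inhomogeneous term the shape
    required by \<open>sawtooth_iterated_integral\<close>.\<close>
  define g where "g s = indicator {r<..1} s * f s" for s
  have [measurable]: "g \<in> borel_measurable borel" unfolding g_def[abs_def] by measurable
  have gb: "\<bar>g s\<bar> \<le> A / 2" for s using f_bound[of s] by (auto simp: g_def indicator_def)
  have rx: "0 \<le> r * x" "r * x \<le> x" "r * x \<le> 1" using x r by (auto intro: mult_le_one)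
  define T where "T v = (\<integral>w. sawtooth (r * v * w) * diff r w \<partial>unit_lborel)" for v
  define S where "S v = (\<integral>w. sawtooth (1 * v * w) * g w \<partial>unit_lborel)" for v
  have [measurable]: "T \<in> borel_measurable borel" "S \<in> borel_measurable borel"
    unfolding T_def[abs_def] S_def[abs_def] by (rule borel_measurable_unit_integral; measurable)+
  have Tb: "\<bar>T v\<bar> \<le> 1/2 * A" for v
  proof -
    have "\<bar>T v\<bar> \<le> (\<integral>w. 1/2 * A \<partial>unit_lborel)"
      unfolding T_def
    proof (rule abs_integral_unit_lborel_le)
      show "\<bar>sawtooth (r * v * w) * diff r w\<bar> \<le> 1/2 * A" for w
        unfolding abs_mult by (intro mult_mono sawtooth_bound diff_bound_trivial) auto
    qed (auto intro: integrable_unit_lborel_bounded)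
    then show ?thesis unfolding integral_unit_lborel_const .
  qed
  have Sb: "\<bar>S v\<bar> \<le> 1/2 * (A / 2)" for v
  proof -
    have "\<bar>S v\<bar> \<le> (\<integral>w. 1/2 * (A / 2) \<partial>unit_lborel)"
      unfolding S_def
    proof (rule abs_integral_unit_lborel_le)
      show "\<bar>sawtooth (1 * v * w) * g w\<bar> \<le> 1/2 * (A / 2)" for w
        unfolding abs_mult by (intro mult_mono sawtooth_bound gb) auto
    qed (auto intro: integrable_unit_lborel_bounded)
    then show ?thesis unfolding integral_unit_lborel_const .
  qed
  have iT: "integrable unit_lborel (\<lambda>v. sawtooth (r * x * v) * T v)"
  proof (rule integrable_unit_lborel_bounded)
    show "\<bar>sawtooth (r * x * v) * T v\<bar> \<le> 1/2 * (1/2 * A)" for v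
      unfolding abs_mult by (intro mult_mono sawtooth_bound Tb) auto
  qed measurable
  have iS: "integrable unit_lborel (\<lambda>v. sawtooth (r * x * v) * S v)"
  proof (rule integrable_unit_lborel_bounded)
    show "\<bar>sawtooth (r * x * v) * S v\<bar> \<le> 1/2 * (1/2 * (A / 2))" for v
      unfolding abs_mult by (intro mult_mono sawtooth_bound Sb) auto
  qed measurable
  have "r * (\<integral>v. sawtooth (r * x * v) * diff r v \<partial>unit_lborel)
      = (\<integral>v. r * (sawtooth (r * x * v) * diff r v) \<partial>unit_lborel)" by simp
  also have "\<dots> = (\<integral>v. (- (1 - r)) * (sawtooth (r * x * v) * f v) - (lam * r) * (sawtooth (r * x * v) * T v)
                  + lam * (sawtooth (r * x * v) * S v) \<partial>unit_lborel)"
  proof (rule Bochner_Integration.integral_cong[OF refl])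
    fix v assume v: "v \<in> space unit_lborel"
    have Sv: "S v = (\<integral>s. indicator {r<..1} s * (sawtooth (v * s) * f s) \<partial>unit_lborel)"
      unfolding S_def g_def by (simp add: mult_ac)
    have Tv: "T v = (\<integral>w. sawtooth (r * v * w) * diff r w \<partial>unit_lborel)"
      by (simp add: T_def)
    have "r * diff r v = - (1 - r) * f v - lam * (r * T v) + lam * S v"
      unfolding Sv Tv using v r by (intro diff_equation) (auto simp: space_restrict_space)
    then have "sawtooth (r * x * v) * (r * diff r v) = sawtooth (r * x * v) * (- (1 - r) * f v - lam * (r * T v) + lam * S v)"
      by simp
    then show "r * (sawtooth (r * x * v) * diff r v) = (- (1 - r)) * (sawtooth (r * x * v) * f v) - (lam * r) * (sawtooth (r * x * v) * T v)
                  + lam * (sawtooth (r * x * v) * S v)"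
      by (simp add: algebra_simps)
  qed
  also have "\<dots> = (- (1 - r)) * (\<integral>v. sawtooth (r * x * v) * f v \<partial>unit_lborel)
      - (lam * r) * (\<integral>v. sawtooth (r * x * v) * T v \<partial>unit_lborel) + lam * (\<integral>v. sawtooth (r * x * v) * S v \<partial>unit_lborel)"
  proof -
    note i = sawtooth_f_integrable[of "r * x", THEN integrable_mult_right, of "- (1 - r)"]
      iT[THEN integrable_mult_right, of "lam * r"] iS[THEN integrable_mult_right, of lam]
    show ?thesis
      by (simp only: Bochner_Integration.integral_add[OF Bochner_Integration.integrable_diff[OF i(1,2)] i(3)]
        Bochner_Integration.integral_diff[OF i(1,2)] integral_mult_right_zero)
  qed
  finally have "\<bar>r * (\<integral>v. sawtooth (r * x * v) * diff r v \<partial>unit_lborel)\<bar>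
     \<le> \<bar>(- (1 - r)) * (\<integral>v. sawtooth (r * x * v) * f v \<partial>unit_lborel)\<bar>
      + \<bar>(lam * r) * (\<integral>v. sawtooth (r * x * v) * T v \<partial>unit_lborel)\<bar> + \<bar>lam * (\<integral>v. sawtooth (r * x * v) * S v \<partial>unit_lborel)\<bar>"
    by (simp only:)
  also have "\<dots> \<le> (1 - r) * (A\<^sup>2 / 2 * L) + A * ((1 - r) * M * L) + A * ((1 - r) * (A / 2) * L)"
  proof (intro add_mono)
    \<comment> \<open>Up to sign this integral is f(rx)/A, so the decay of f applies with one power
      of A to spare.\<close>
    have "A * \<bar>\<integral>v. sawtooth (r * x * v) * f v \<partial>unit_lborel\<bar> = \<bar>f (r * x)\<bar>"
      using eigen[of "r * x"] rx by (simp add: abs_mult)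
    also have "\<dots> \<le> A ^ 3 / 2 * L"
      unfolding L_def using rx x by (intro f_decay) auto
    also have "\<dots> = A * (A\<^sup>2 / 2 * L)"
      by (simp add: power3_eq_cube power2_eq_square)
    finally have "\<bar>\<integral>v. sawtooth (r * x * v) * f v \<partial>unit_lborel\<bar> \<le> A\<^sup>2 / 2 * L"
      using lam_ge by (simp only: mult_le_cancel_left_pos)
    then show "\<bar>(- (1 - r)) * (\<integral>v. sawtooth (r * x * v) * f v \<partial>unit_lborel)\<bar> \<le> (1 - r) * (A\<^sup>2 / 2 * L)"
      unfolding abs_mult using r by (intro mult_mono) auto
    have "\<bar>\<integral>v. sawtooth (r * x * v) * T v \<partial>unit_lborel\<bar> \<le> (1 - r) * M * L"
      unfolding L_def T_def using x r rx diff_bound[OF r]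
      by (intro sawtooth_iterated_integral_bound) auto
    then show "\<bar>(lam * r) * (\<integral>v. sawtooth (r * x * v) * T v \<partial>unit_lborel)\<bar> \<le> A * ((1 - r) * M * L)"
      unfolding abs_mult using r mult_left_mono[of "\<bar>r\<bar>" 1 A] by (intro mult_mono) auto
    \<comment> \<open>The general iterated bound would lose the factor 1 - r. Here w > r, so the
      iterated kernel is at most rx/w \<le> x, and the integration runs over length 1 - r.\<close>
    have "\<bar>\<integral>v. sawtooth (r * x * v) * S v \<partial>unit_lborel\<bar> = \<bar>\<integral>w. g w * sawtooth2 (r * x) (1 * w) \<partial>unit_lborel\<bar>"
      unfolding S_def by (subst sawtooth_iterated_integral[OF _ gb]) auto
    also have "\<dots> \<le> (\<integral>w. (A / 2 * x) * indicator {r<..1} w \<partial>unit_lborel)"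
    proof (rule abs_integral_unit_lborel_le)
      show "integrable unit_lborel (\<lambda>w. (A / 2 * x) * indicator {r<..1} w)"
        by (rule integrable_unit_lborel_bounded[where B = "A / 2 * x"]) (use x in \<open>auto simp: indicator_def\<close>)
      fix w :: real assume w: "w \<in> {0..1}"
      show "\<bar>g w * sawtooth2 (r * x) (1 * w)\<bar> \<le> (A / 2 * x) * indicator {r<..1} w"
      proof (cases "r < w")
        case True
        have "\<bar>sawtooth2 (r * x) (1 * w)\<bar> \<le> min 1 (r * x / (1 * w))"
          using rx w by (intro sawtooth2_bound) auto
        also have "\<dots> \<le> r * x / w" by simp
        also have "\<dots> \<le> x"
          using True r x by (simp add: field_simps)
        finally have "\<bar>sawtooth2 (r * x) (1 * w)\<bar> \<le> x" .
        then have "\<bar>g w * sawtooth2 (r * x) (1 * w)\<bar> \<le> A / 2 * x"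
          unfolding abs_mult using gb[of w] by (intro mult_mono) auto
        then show ?thesis using True w by simp
      qed (simp add: g_def)
    qed measurable
    also have "\<dots> = (A / 2 * x) * (1 - r)"
      using integral_unit_indicator(2)[of r] r by (simp only: integral_mult_right_zero)
    also have "\<dots> \<le> (1 - r) * (A / 2) * L"
      using xL r mult_left_mono[OF xL, of "(1 - r) * (A / 2)"] by (simp add: mult_ac)
    finally show "\<bar>lam * (\<integral>v. sawtooth (r * x * v) * S v \<partial>unit_lborel)\<bar> \<le> A * ((1 - r) * (A / 2) * L)"
      unfolding abs_mult by (intro mult_left_mono) auto
  qed
  also have "\<dots> = (1 - r) * ((A\<^sup>2 + A * M) * L)"
    by (simp add: field_simps power2_eq_square)
  finally show ?thesis unfolding L_def .
qed

text \<open>\<open>diff_equation\<close> divided by 1 - r, in the limit from the left: the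
  difference tends to x d, the inhomogeneous term to \<lambda> k(x) f(1), and the other terms stay
  below a bound R independent of r.\<close>

theorem derivative_estimate:
  assumes x: "0 < x" "x \<le> 1" and d: "(f has_real_derivative d) (at x within {0..1})"
  shows "\<bar>x * d - lam * (sawtooth x * f 1)\<bar> \<le> 366 * A ^ 5 * (ln A)\<^sup>2 * (1 + ln (1 / x)) * x"
proof -
  define L where "L = x * (1 + ln (1 / x))"
  define J where "J r = (\<integral>s. indicator {r<..1} s * (sawtooth (x * s) * f s) \<partial>unit_lborel)" for r
  define R where "R = A ^ 3 / 2 * L + A * ((A\<^sup>2 + A * M) * L)"
  have L0: "0 \<le> L" using x by (auto simp: L_def)
  have near1: "eventually (\<lambda>r. r \<in> {1/2<..<1::real}) (at_left 1)"
    by (rule eventually_at_left_real) simp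
  have est: "eventually (\<lambda>r. \<bar>r * (diff r x / (1 - r)) - lam * (J r / (1 - r))\<bar> \<le> R) (at_left 1)"
    using near1
  proof eventually_elim
    case (elim r)
    then have r: "1/2 \<le> r" "r < 1" by auto
    define T where "T = r * (\<integral>v. sawtooth (r * x * v) * diff r v \<partial>unit_lborel)"
    have "r * diff r x - lam * J r = - (1 - r) * f x - lam * T"
      using diff_equation[of x r] x r by (simp add: J_def T_def)
    then have "\<bar>r * diff r x - lam * J r\<bar> \<le> \<bar>(- (1 - r)) * f x\<bar> + \<bar>lam * T\<bar>" by linarith
    also have "\<dots> \<le> (1 - r) * (A ^ 3 / 2 * L) + A * ((1 - r) * ((A\<^sup>2 + A * M) * L))"
    proof -
      have fx: "\<bar>f x\<bar> \<le> A ^ 3 / 2 * L" unfolding L_def using x by (intro f_decay) auto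
      have Tx: "\<bar>T\<bar> \<le> (1 - r) * ((A\<^sup>2 + A * M) * L)"
        unfolding L_def T_def by (rule sawtooth_diff_integral_bound[OF x r])
      show ?thesis unfolding abs_mult using r by (intro add_mono mult_mono fx Tx) auto
    qed
    also have "\<dots> = (1 - r) * R" by (simp add: R_def algebra_simps)
    finally have le: "\<bar>r * diff r x - lam * J r\<bar> / (1 - r) \<le> R"
      using r by (simp add: field_simps)
    have "r * (diff r x / (1 - r)) - lam * (J r / (1 - r)) = (r * diff r x - lam * J r) / (1 - r)"
      by (simp add: diff_divide_distrib)
    then have "\<bar>r * (diff r x / (1 - r)) - lam * (J r / (1 - r))\<bar> = \<bar>r * diff r x - lam * J r\<bar> / (1 - r)"
      using r by simp
    with le show ?case by simp
  qed
  have lim1: "((\<lambda>r. diff r x / (1 - r)) \<longlongrightarrow> x * d) (at_left 1)"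
  proof -
    \<comment> \<open>The points rx approach x from below inside [0, 1], so x = 1 needs no separate
      treatment.\<close>
    have fl: "filterlim (\<lambda>r. r * x) (at x within {0..1}) (at_left 1)"
      unfolding filterlim_at
    proof (intro conjI)
      show "eventually (\<lambda>r. r * x \<in> {0..1} \<and> r * x \<noteq> x) (at_left 1)"
        using near1 by eventually_elim (use x in \<open>auto intro: mult_le_one\<close>)
      show "((\<lambda>r. r * x) \<longlongrightarrow> x) (at_left 1)"
        by (auto intro!: tendsto_eq_intros)
    qed
    have "((\<lambda>y. (f y - f x) / (y - x)) \<longlongrightarrow> d) (at x within {0..1})"
      using d by (simp add: has_field_derivative_iff)
    from filterlim_compose[OF this fl]
    have "((\<lambda>r. x * ((f (r * x) - f x) / (r * x - x))) \<longlongrightarrow> x * d) (at_left 1)"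
      by (intro tendsto_mult_left)
    moreover have "eventually (\<lambda>r. x * ((f (r * x) - f x) / (r * x - x)) = diff r x / (1 - r)) (at_left 1)"
      using near1
    proof eventually_elim
      case (elim r)
      have "r * x - x = - ((1 - r) * x)" by (simp add: algebra_simps)
      moreover have "f (r * x) - f x = - diff r x" using x by (simp add: diff_def)
      ultimately show ?case using x elim by simp
    qed
    ultimately show ?thesis by (rule Lim_transform_eventually)
  qed
  have lim2: "((\<lambda>r. J r / (1 - r)) \<longlongrightarrow> sawtooth x * f 1) (at_left 1)"
    using average_tendsto_left_limit[of "\<lambda>s. sawtooth (x * s) * f s" "1/2 * (A / 2)"] sawtooth_f_bound
      tendsto_mult[OF sawtooth_left_continuous[OF x(1)] f_left_continuous_1]
    by (simp add: J_def)
  have "((\<lambda>r. \<bar>r * (diff r x / (1 - r)) - lam * (J r / (1 - r))\<bar>) \<longlongrightarrow> \<bar>1 * (x * d) - lam * (sawtooth x * f 1)\<bar>) (at_left 1)"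
    by (intro tendsto_intros lim1 lim2)
  then have "\<bar>1 * (x * d) - lam * (sawtooth x * f 1)\<bar> \<le> R"
    by (rule tendsto_upperbound[OF _ est]) simp
  \<comment> \<open>M contributes 364; the remaining (3/2) A^3 is at most 2 A^5 (ln A)^2, because A
    \<ge> 2 and ln A \<ge> 1/2.\<close>
  also have "R \<le> (366 * (A ^ 5 * (ln A)\<^sup>2)) * L"
  proof -
    have lnA: "1/2 \<le> ln A" by (rule half_le_ln[OF lam_ge])
    have "1/2 * (1/2) \<le> ln A * ln A" using lnA by (intro mult_mono) auto
    then have l4: "1/4 \<le> (ln A)\<^sup>2" by (simp add: power2_eq_square)
    have "2\<^sup>2 \<le> A\<^sup>2" using lam_ge by (intro power_mono) auto
    then have "4 * A ^ 3 \<le> A\<^sup>2 * A ^ 3" by (intro mult_right_mono) auto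
    moreover have "A\<^sup>2 * A ^ 3 = A ^ 5" by (simp only: power_add[symmetric]) simp
    ultimately have "4 * A ^ 3 \<le> A ^ 5" by simp
    moreover have "A ^ 5 * (1/4) \<le> A ^ 5 * (ln A)\<^sup>2" using l4 by (intro mult_left_mono) auto
    ultimately have "A ^ 3 \<le> A ^ 5 * (ln A)\<^sup>2" by linarith
    moreover have "A * (A * M) = 364 * (A ^ 5 * (ln A)\<^sup>2)"
      unfolding M_def by (simp add: power_numeral_reduce mult_ac)
    moreover have "A * A\<^sup>2 = A ^ 3" by (simp add: power3_eq_cube power2_eq_square)
    moreover have "A * (A\<^sup>2 + A * M) = A * A\<^sup>2 + A * (A * M)" by (rule distrib_left)
    moreover have "0 \<le> A ^ 3" by simp
    ultimately have "A ^ 3 / 2 + A * (A\<^sup>2 + A * M) \<le> 366 * (A ^ 5 * (ln A)\<^sup>2)" by linarith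
    from mult_right_mono[OF this L0] show ?thesis by (simp add: R_def algebra_simps)
  qed
  also have "\<dots> = 366 * A ^ 5 * (ln A)\<^sup>2 * (1 + ln (1 / x)) * x"
    by (simp only: L_def mult_ac)
  finally show ?thesis by simp
qed

end

text \<open>Choose a Borel function g equal to the eigenfunction almost everywhere and apply the
  integral operator to g. The result is Borel, and it equals the eigenfunction at every point of
  [0, 1] because the eigenvalue equation holds at every point.\<close>

lemma eigenfun_bounded_eigenfunction:
  assumes eig: "eigenfun p lam" and norm: "inner01 p p = 1"
  obtains f where "bounded_eigenfunction f lam" "\<And>x. x \<in> {0..1} \<Longrightarrow> f x = p x"
proof -
  define q where "q = (\<lambda>x. indicator {0..1} x *\<^sub>R p x)"
  have q: "q \<in> borel_measurable lebesgue"
    using eig by (simp add: eigenfun_def L2_01_def set_borel_measurable_def q_def)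
  then obtain g where g [measurable]: "g \<in> borel_measurable lborel" and "AE x in lborel. q x = g x"
    using completion_ex_borel_measurable_real by blast
  then have ae: "AE x in lborel. q x = g x" and aec: "AE x in lebesgue. q x = g x"
    by (auto intro: AE_completion)
  have [measurable]: "g \<in> borel_measurable borel" using g by simp
  have U: "(\<integral>x. h x \<partial>unit_lborel) = (\<integral>x. indicator {0..1} x * h x \<partial>lborel)" for h :: "real \<Rightarrow> real"
    by (simp add: integral_restrict_space)
  \<comment> \<open>The image of g, not g itself: g agrees with the eigenfunction only almost
    everywhere, which would not carry over its values or derivative at a point.\<close>
  define f where "f x = indicator {0..1} x * (lam * (\<integral>y. sawtooth (x * y) * g y \<partial>unit_lborel))" for x
  have [measurable]: "(\<lambda>x. \<integral>y. sawtooth (x * y) * g y \<partial>unit_lborel) \<in> borel_measurable borel"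
    by (rule borel_measurable_unit_integral) measurable
  have fm [measurable]: "f \<in> borel_measurable borel"
    unfolding f_def[abs_def] by measurable
  have fp: "f x = p x" if x: "x \<in> {0..1}" for x
  proof -
    have "p x = lam * (LINT y:{0..1}|lebesgue. Kker x y * p y)"
      using eig x by (simp add: eigenfun_def)
    also have "(LINT y:{0..1}|lebesgue. Kker x y * p y) = (\<integral>y. sawtooth (x * y) * q y \<partial>lebesgue)"
      by (simp add: set_lebesgue_integral_def Kker_eq_sawtooth q_def mult_ac)
    also have "\<dots> = (\<integral>y. indicator {0..1} y * (sawtooth (x * y) * g y) \<partial>lebesgue)"
    proof (rule integral_cong_AE)
      show "AE y in lebesgue. sawtooth (x * y) * q y = indicator {0..1} y * (sawtooth (x * y) * g y)"
        using aec by eventually_elim (auto simp: q_def split: split_indicator split_indicator_asm)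
      show "(\<lambda>y. sawtooth (x * y) * q y) \<in> borel_measurable lebesgue"
        by (intro borel_measurable_times q measurable_completion) measurable
      show "(\<lambda>y. indicator {0..1} y * (sawtooth (x * y) * g y)) \<in> borel_measurable lebesgue"
        by (intro measurable_completion) measurable
    qed
    also have "\<dots> = (\<integral>y. sawtooth (x * y) * g y \<partial>unit_lborel)"
      unfolding U by (rule integral_completion) measurable
    finally show ?thesis using x by (simp add: f_def)
  qed
  have fg: "AE x in lborel. indicator {0..1} x * f x = indicator {0..1} x * g x"
    using ae by eventually_elim (auto simp: q_def indicator_def fp)
  have sq: "integrable lborel (\<lambda>x. indicator {0..1} x * (g x)\<^sup>2)" "(\<integral>x. (g x)\<^sup>2 \<partial>unit_lborel) = 1"
  proof -
    have e: "AE x in lebesgue. indicator {0..1} x * (p x)\<^sup>2 = indicator {0..1} x * (g x)\<^sup>2"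
      using aec by eventually_elim (auto simp: q_def indicator_def)
    have gm: "(\<lambda>x. indicator {0..1} x * (g x)\<^sup>2) \<in> borel_measurable lborel" by measurable
    have pi: "integrable lebesgue (\<lambda>x. indicator {0..1} x * (p x)\<^sup>2)"
      using eig by (simp add: eigenfun_def L2_01_def set_integrable_def)
    have "integrable lebesgue (\<lambda>x. indicator {0..1} x * (g x)\<^sup>2)"
      using integrable_cong_AE_imp[OF pi measurable_completion[OF gm]] e by auto
    then show "integrable lborel (\<lambda>x. indicator {0..1} x * (g x)\<^sup>2)"
      using integrable_completion[OF gm] by simp
    have "(\<integral>x. indicator {0..1} x * (g x)\<^sup>2 \<partial>lborel) = (\<integral>x. indicator {0..1} x * (g x)\<^sup>2 \<partial>lebesgue)"
      by (rule integral_completion[OF gm, symmetric])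
    also have "\<dots> = (\<integral>x. indicator {0..1} x * (p x)\<^sup>2 \<partial>lebesgue)"
      by (rule integral_cong_AE[symmetric])
         (use e borel_measurable_integrable[OF pi] measurable_completion[OF gm] in auto)
    also have "\<dots> = 1"
      using norm by (simp add: inner01_def set_lebesgue_integral_def power2_eq_square)
    finally show "(\<integral>x. (g x)\<^sup>2 \<partial>unit_lborel) = 1" unfolding U .
  qed
  have sqU: "integrable unit_lborel (\<lambda>x. (g x)\<^sup>2)"
    using sq(1) by (simp add: integrable_restrict_space)
  have fb: "\<bar>f x\<bar> \<le> \<bar>lam\<bar> / 2" for x
  proof -
    have ic: "integrable unit_lborel (\<lambda>_. 1/4 :: real)"
      by (rule integrable_unit_lborel_bounded[where B = "1/4"]) auto
    have ig: "integrable unit_lborel (\<lambda>y. 1/4 * (g y)\<^sup>2)"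
      using sqU by (rule integrable_mult_right)
    have "\<bar>\<integral>y. sawtooth (x * y) * g y \<partial>unit_lborel\<bar> \<le> (\<integral>y. 1/4 + 1/4 * (g y)\<^sup>2 \<partial>unit_lborel)"
    proof (rule abs_integral_unit_lborel_le)
      show "integrable unit_lborel (\<lambda>y. 1/4 + 1/4 * (g y)\<^sup>2)"
        by (rule Bochner_Integration.integrable_add[OF ic ig])
      \<comment> \<open>From 2|g| \<le> 1 + g^2, in place of the Cauchy-Schwarz inequality; with
        norm one both summands integrate to 1/4.\<close>
      show "\<bar>sawtooth (x * y) * g y\<bar> \<le> 1/4 + 1/4 * (g y)\<^sup>2" for y
      proof -
        have "\<bar>sawtooth (x * y) * g y\<bar> \<le> 1/2 * \<bar>g y\<bar>"
          unfolding abs_mult by (intro mult_right_mono sawtooth_bound) auto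
        moreover have "0 \<le> (\<bar>g y\<bar> - 1)\<^sup>2" by simp
        then have "2 * \<bar>g y\<bar> \<le> 1 + (g y)\<^sup>2" by (simp add: power2_diff)
        ultimately show ?thesis by simp
      qed
    qed measurable
    also have "\<dots> = (\<integral>y. 1/4 \<partial>unit_lborel) + (\<integral>y. 1/4 * (g y)\<^sup>2 \<partial>unit_lborel)"
      by (rule Bochner_Integration.integral_add[OF ic ig])
    also have "\<dots> = 1/2"
      using sq(2) by (simp only: integral_unit_lborel_const integral_mult_right_zero)
    finally have "\<bar>lam\<bar> * \<bar>\<integral>y. sawtooth (x * y) * g y \<partial>unit_lborel\<bar> \<le> \<bar>lam\<bar> * (1/2)"
      by (intro mult_left_mono) auto
    then show ?thesis by (auto simp: f_def indicator_def abs_mult)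
  qed
  have "bounded_eigenfunction f lam"
  proof
    show "f \<in> borel_measurable borel" by fact
    show "\<bar>f x\<bar> \<le> \<bar>lam\<bar> / 2" for x by fact
    have "(\<integral>x. (g x)\<^sup>2 \<partial>unit_lborel) = (\<integral>x. (f x)\<^sup>2 \<partial>unit_lborel)"
      unfolding U
    proof (rule integral_cong_AE)
      show "AE x in lborel. indicator {0..1} x * (g x)\<^sup>2 = indicator {0..1} x * (f x)\<^sup>2"
        using fg by eventually_elim (auto simp: indicator_def)
    qed measurable
    then have "1 = \<bar>\<integral>x. (f x)\<^sup>2 \<partial>unit_lborel\<bar>" using sq(2) by simp
    also have "\<dots> \<le> (\<integral>x. (\<bar>lam\<bar> / 2)\<^sup>2 \<partial>unit_lborel)"
    proof (rule abs_integral_unit_lborel_le)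
      show "\<bar>(f x)\<^sup>2\<bar> \<le> (\<bar>lam\<bar> / 2)\<^sup>2" for x
        using power_mono[OF fb[of x], of 2] by simp
    qed (auto intro: integrable_unit_lborel_bounded)
    \<comment> \<open>Norm one against the uniform bound |\<lambda>|/2 forces |\<lambda>| \<ge>
      2.\<close>
    finally have "1\<^sup>2 \<le> (\<bar>lam\<bar> / 2)\<^sup>2" unfolding integral_unit_lborel_const by simp
    then have "1 \<le> \<bar>lam\<bar> / 2" by (rule power2_le_imp_le) simp
    then show "2 \<le> \<bar>lam\<bar>" by simp
    fix x :: real assume x: "x \<in> {0..1}"
    have "(\<integral>y. sawtooth (x * y) * g y \<partial>unit_lborel) = (\<integral>y. sawtooth (x * y) * f y \<partial>unit_lborel)"
      unfolding U
    proof (rule integral_cong_AE)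
      show "AE y in lborel. indicator {0..1} y * (sawtooth (x * y) * g y) = indicator {0..1} y * (sawtooth (x * y) * f y)"
        using fg by eventually_elim (auto simp: indicator_def)
    qed measurable
    then show "f x = lam * (\<integral>y. sawtooth (x * y) * f y \<partial>unit_lborel)"
      using x by (simp add: f_def[of x])
  qed
  then show thesis using fp by (rule that)
qed

text \<open>The derivative within \<open>{0..1}\<close> is two-sided at interior points and
  one-sided at x = 1.\<close>

theorem theorem5p4:
  shows "\<exists>C>0. \<forall>phi lam. eigen_system phi lam \<longrightarrow>
     (\<forall>j\<ge>1. \<forall>x\<in>{0<..1}. \<forall>d. ((phi j) has_real_derivative d) (at x within {0..1}) \<longrightarrow>
        \<bar>x * d + lam j * phi j 1 * B1per (1 / x)\<bar>
          \<le> C * \<bar>lam j\<bar> ^ 5 * (ln \<bar>lam j\<bar>)\<^sup>2 * (1 + ln (1 / x)) * x)"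
proof (intro exI[of _ 366] conjI allI impI ballI)
  fix phi lam and j :: nat and x d :: real
  assume sys: "eigen_system phi lam" and j: "1 \<le> j" and x: "x \<in> {0<..1}"
    and d: "(phi j has_real_derivative d) (at x within {0..1})"
  have "eigenfun (phi j) (lam j)" "inner01 (phi j) (phi j) = 1"
    using sys j by (auto simp: eigen_system_def)
  then obtain f where f: "bounded_eigenfunction f (lam j)" and eq: "\<And>x. x \<in> {0..1} \<Longrightarrow> f x = phi j x"
    by (rule eigenfun_bounded_eigenfunction) blast
  have "(f has_real_derivative d) (at x within {0..1})"
    using d by (rule has_field_derivative_transform_within[OF _ zero_less_one]) (use x eq in auto)
  then have "\<bar>x * d - lam j * (sawtooth x * f 1)\<bar>
      \<le> 366 * \<bar>lam j\<bar> ^ 5 * (ln \<bar>lam j\<bar>)\<^sup>2 * (1 + ln (1 / x)) * x"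
    using x by (intro bounded_eigenfunction.derivative_estimate[OF f]) auto
  \<comment> \<open>For x > 0 the kernel \<open>sawtooth x\<close> is
    \<open>- B1per (1 / x)\<close>, which accounts for the change of sign.\<close>
  moreover have "x * d - lam j * (sawtooth x * f 1) = x * d + lam j * phi j 1 * B1per (1 / x)"
    using x eq[of 1] by (simp add: sawtooth_def B1per_def algebra_simps)
  ultimately show "\<bar>x * d + lam j * phi j 1 * B1per (1 / x)\<bar>
      \<le> 366 * \<bar>lam j\<bar> ^ 5 * (ln \<bar>lam j\<bar>)\<^sup>2 * (1 + ln (1 / x)) * x"
    by simp
qed simp

end
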